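(* Let $\mathbf V=(\mathbf v_1,\dots,\mathbf v_n)$ be a configuration of vectors in $\mathbb R^d$. Then the map $\mathfrak T\mapsto \operatorname{Vert}(\mathfrak T)$ is a bijection between the set of fine zonotopal tilings of the zonotope $\mathcal Z_{\mathbf V}$ and the set of $\mathbf V$-separated collections $\mathcal S\subseteq 2^{[n]}$ that are maximal by size. Moreover, every maximal-by-size $\mathbf V$-separated collection has exactly $|\mathrm{Ind}(\mathbf V)|$ elements, where $\mathrm{Ind}(\mathbf V)$ is the set of subsets $I\subseteq[n]$ such that the vectors $\mathbf v_i$, $i\in I$, are linearly independent.
   Context: Two subsets $I,J\subseteq[n]$ are $\mathbf V$-separated if there is a linear function $h:\mathbb R^d\to\mathbb R$ with $h(\mathbf v_i)>0$ for all $i\in I\setminus J$ and $h(\mathbf v_j)<0$ for all $j\in J\setminus I$. A collection $\mathcal S\subseteq 2^{[n]}$ is $\mathbf V$-separated if any two of its members are $\mathbf V$-separated; it is maximal by size if its cardinality is the largest possible among all $\mathbf V$-separated collections. The zonotope is $\mathcal Z_{\mathbf V}=[0,\mathbf v_1]+\dots+[0,\mathbf v_n]$ (Minkowski sum), the image of the cube $\square_n=[0,e_1]+\dots+[0,e_n]\subset\mathbb R^n$ under the linear map $p:\mathbb R^n\to\mathbb R^d$, $p(e_i)=\mathbf v_i$. A fine zonotopal tiling of $\mathcal Z_{\mathbf V}$ is a collection $\mathfrak T$ of faces of $\square_n$, closed under taking faces, such that $p$ restricts to a homeomorphism from $\bigcup_{F\in\mathfrak T}F$ onto $\mathcal Z_{\mathbf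 V}$. Vertices of $\square_n$ are the points $\sum_{i\in I}e_i$, labeled by $I\subseteq[n]$, and $\operatorname{Vert}(\mathfrak T)\subseteq 2^{[n]}$ is the set of labels $I$ of the vertices of $\square_n$ that belong to $\mathfrak T$. *)

theory Defs
  imports "HOL-Analysis.Analysis"
begin

text \<open>The ground set [n] is the finite type 'n; a configuration is V :: 'n \<Rightarrow> 'a
  with 'a a Euclidean space R^d. Points of R^n are real^'n.\<close>

definition V_separated :: "('n \<Rightarrow> 'a::euclidean_space) \<Rightarrow> 'n set \<Rightarrow> 'n set \<Rightarrow> bool" where
  "V_separated V I J \<longleftrightarrow>
     (\<exists>h :: 'a \<Rightarrow> real. linear h \<and> (\<forall>i \<in> I - J. h (V i) > 0) \<and> (\<forall>j \<in> J - I. h (V j) < 0))"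

definition V_separated_collection :: "('n \<Rightarrow> 'a::euclidean_space) \<Rightarrow> 'n set set \<Rightarrow> bool" where
  "V_separated_collection V S \<longleftrightarrow> (\<forall>I\<in>S. \<forall>J\<in>S. V_separated V I J)"

definition max_by_size_separated :: "('n::finite \<Rightarrow> 'a::euclidean_space) \<Rightarrow> 'n set set \<Rightarrow> bool" where
  "max_by_size_separated V S \<longleftrightarrow> V_separated_collection V S \<and>
     (\<forall>S'. V_separated_collection V S' \<longrightarrow> card S' \<le> card S)"

definition unit_cube :: "(real^'n::finite) set" where
  "unit_cube = {x. \<forall>i. 0 \<le> x $ i \<and> x $ i \<le> 1}"

definition cube_proj :: "('n::finite \<Rightarrow> 'a::euclidean_space) \<Rightarrow> real^'n \<Rightarrow> 'a" where
  "cube_proj V x = (\<Sum>i\<in>UNIV. x $ i *\<^sub>R V i)"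

definition zonotope :: "('n::finite \<Rightarrow> 'a::euclidean_space) \<Rightarrow> 'a set" where
  "zonotope V = cube_proj V ` unit_cube"

definition cube_vertex :: "'n::finite set \<Rightarrow> real^'n" where
  "cube_vertex I = (\<chi> i. if i \<in> I then 1 else 0)"

definition fine_zonotopal_tiling :: "('n::finite \<Rightarrow> 'a::euclidean_space) \<Rightarrow> (real^'n) set set \<Rightarrow> bool" where
  "fine_zonotopal_tiling V T \<longleftrightarrow>
     (\<forall>F\<in>T. F face_of unit_cube) \<and>
     (\<forall>F\<in>T. \<forall>G. G face_of F \<longrightarrow> G \<in> T) \<and>
     (\<exists>g. homeomorphism (\<Union>T) (zonotope V) (cube_proj V) g)"

definition Vert :: "(real^'n::finite) set set \<Rightarrow> 'n set set" where
  "Vert T = {I. {cube_vertex I} \<in> T}"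

definition Ind :: "('n \<Rightarrow> 'a::euclidean_space) \<Rightarrow> 'n set set" where
  "Ind V = {I. inj_on V I \<and> independent (V ` I)}"

end

theory Submission
  imports Defs
begin

text \<open>A fine zonotopal tiling is the same as its union Q, a subcomplex of the cube that the projection p
  maps bijectively onto the zonotope. By Gordan's theorem, I and J are V-separated iff the kernel
  of p contains no nonzero u whose positive part is supported in I - J and negative part in J - I.

  Deleting n flattens Q along the n-th axis; contracting n keeps the part of Q that is a prism in
  that direction. Both operations produce sections again, because the n-th coordinate of the lift is
  monotone along lines in direction V n. This gives |Vert| = |Ind| by the recursion
  |Ind V| = |Ind (V - n)| + |Ind (V / n)|, and the same recursion bounds the size of any separated
  collection. The vertex labels are separated because deletion reduces a violating u to a circuit,
  where each fibre of p is a segment and, by connectedness, Q consistently uses one of its two ends.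

  Conversely, for a separated S let Q(S) be the union of the cells with all vertices in S. Separation
  makes p injective on Q(S). If |S| = |Ind V|, the deletion and the contraction of S are maximal too,
  so by induction they span sections; the second one cuts the first into a part below, which is kept,
  and a part above, which is shifted by V n, with a prism layer in between.\<close>

section \<open>Cells of the cube\<close>

text \<open>The ambient space and the vector type never change in the recursion: a smaller ground
  set is a set \<open>E\<close> of coordinates allowed to be nonzero, and V / n is realised by
  projecting orthogonally along \<open>V n\<close> inside the same space. So every notion is
  relative to \<open>E\<close>, and one induction on \<open>card E\<close> serves deletion and
  contraction alike. A zero vector cannot be contracted; it is a separate case, in which only
  deletion contributes to the count.

  Continuity comes from compactness: a union of cells is compact, so injectivity of p on it makes
  the inverse continuous, and this continuous lift carries all intermediate value arguments. Two
  further points close the proof. The bound |Ind V| is attained only because some section exists,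
  and one is built by adding vectors one at a time. A section is recovered from its labels S because
  it lies in Q(S), where p is injective, while it covers the zonotope by itself.\<close>

definition subcube :: "'n::finite set \<Rightarrow> (real^'n) set" where
  "subcube E = {x. \<forall>i. 0 \<le> x $ i \<and> x $ i \<le> 1 \<and> (i \<notin> E \<longrightarrow> x $ i = 0)}"

text \<open>y lies in the smallest face of the cube that contains x.\<close>

definition carried_by :: "real^'n::finite \<Rightarrow> real^'n \<Rightarrow> bool" where
  "carried_by y x \<longleftrightarrow> (\<forall>i. (x $ i = 0 \<longrightarrow> y $ i = 0) \<and> (x $ i = 1 \<longrightarrow> y $ i = 1))"

text \<open>A subcomplex of the cube, encoded as its underlying point set.\<close>

definition facial :: "'n::finite set \<Rightarrow> (real^'n) set \<Rightarrow> bool" where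
  "facial E Q \<longleftrightarrow> Q \<subseteq> subcube E \<and> (\<forall>x\<in>Q. \<forall>y\<in>subcube E. carried_by y x \<longrightarrow> y \<in> Q)"

definition cubical_section :: "'n::finite set \<Rightarrow> ('n \<Rightarrow> 'a::euclidean_space) \<Rightarrow> (real^'n) set \<Rightarrow> bool" where
  "cubical_section E V Q \<longleftrightarrow>
     facial E Q \<and> inj_on (cube_proj V) Q \<and> cube_proj V ` Q = cube_proj V ` subcube E"

definition set_coord :: "'n::finite \<Rightarrow> real \<Rightarrow> real^'n \<Rightarrow> real^'n" where
  "set_coord n t x = (\<chi> i. if i = n then t else x $ i)"

text \<open>If V n = 0 then x/0 = 0 makes this V itself.\<close>

definition contraction :: "('n \<Rightarrow> 'a::euclidean_space) \<Rightarrow> 'n \<Rightarrow> 'n \<Rightarrow> 'a" where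
  "contraction V n i = V i - (V i \<bullet> V n / (V n \<bullet> V n)) *\<^sub>R V n"

definition vertex_labels :: "(real^'n::finite) set \<Rightarrow> 'n set set" where
  "vertex_labels Q = {I. cube_vertex I \<in> Q}"

text \<open>Independence of the family, so that repeated vectors count as dependent. Phrasing it
  through kernel vectors supported in \<open>I\<close> suits deletion and contraction; for
  \<open>E = UNIV\<close> it is \<open>Ind V\<close>.\<close>

definition ind_sets :: "'n::finite set \<Rightarrow> ('n \<Rightarrow> 'a::euclidean_space) \<Rightarrow> 'n set set" where
  "ind_sets E V = {I. I \<subseteq> E \<and> (\<forall>x. (\<forall>i. i \<notin> I \<longrightarrow> x $ i = 0) \<longrightarrow> cube_proj V x = 0 \<longrightarrow> x = 0)}"

lemma linear_cube_proj: "linear (cube_proj V)"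
  by (rule linearI)
     (simp_all add: cube_proj_def scaleR_left_distrib sum.distrib scaleR_sum_right)

lemmas cube_proj_simps [simp] =
  linear_add [OF linear_cube_proj] linear_diff [OF linear_cube_proj]
  linear_cmul [OF linear_cube_proj] linear_0 [OF linear_cube_proj]

lemma cube_proj_axis [simp]: "cube_proj V (axis n t) = t *\<^sub>R V n"
proof -
  have "cube_proj V (axis n t) = (\<Sum>i\<in>UNIV. if i = n then t *\<^sub>R V i else 0)"
    unfolding cube_proj_def by (rule sum.cong) (auto simp: axis_def)
  then show ?thesis by simp
qed

lemma continuous_on_cube_proj [continuous_intros]: "continuous_on A (cube_proj V)"
  by (rule linear_continuous_on) (simp add: linear_conv_bounded_linear [symmetric] linear_cube_proj)

lemma cube_vertex_nth [simp]: "cube_vertex I $ i = (if i \<in> I then 1 else 0)"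
  by (simp add: cube_vertex_def)

lemma cube_vertex_inject [simp]: "cube_vertex I = cube_vertex J \<longleftrightarrow> I = J"
  by (auto simp: vec_eq_iff split: if_splits)

lemma set_coord_nth [simp]: "set_coord n t x $ i = (if i = n then t else x $ i)"
  by (simp add: set_coord_def)

lemma set_coord_set_coord [simp]: "set_coord n t (set_coord n s x) = set_coord n t x"
  by (simp add: vec_eq_iff)

lemma set_coord_triv [simp]: "x $ n = t \<Longrightarrow> set_coord n t x = x"
  by (auto simp: vec_eq_iff)

lemma set_coord_conv: "set_coord n t x = x + axis n (t - x $ n)"
  by (auto simp: vec_eq_iff axis_def)

lemma cube_proj_set_coord: "cube_proj V (set_coord n t x) = cube_proj V x + (t - x $ n) *\<^sub>R V n"
  unfolding set_coord_conv by simp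

lemma set_coord_in_subcube:
  "x \<in> subcube E \<Longrightarrow> n \<in> E \<Longrightarrow> 0 \<le> t \<Longrightarrow> t \<le> 1 \<Longrightarrow> set_coord n t x \<in> subcube E"
  by (auto simp: subcube_def)

lemma set_coord_0_in_subcube: "x \<in> subcube E \<Longrightarrow> set_coord n 0 x \<in> subcube (E - {n})"
  by (auto simp: subcube_def)

lemma subcube_mono: "E \<subseteq> E' \<Longrightarrow> subcube E \<subseteq> subcube E'"
  by (auto simp: subcube_def)

lemma set_coord_in_subcube_insert:
  "x \<in> subcube (E - {n}) \<Longrightarrow> n \<in> E \<Longrightarrow> 0 \<le> t \<Longrightarrow> t \<le> 1 \<Longrightarrow> set_coord n t x \<in> subcube E"
  by (auto simp: subcube_def)

lemma cube_vertex_in_subcube [simp]: "cube_vertex I \<in> subcube E \<longleftrightarrow> I \<subseteq> E"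
  by (auto simp: subcube_def split: if_splits)

lemma unit_cube_eq: "unit_cube = subcube UNIV"
  by (simp add: unit_cube_def subcube_def)

lemma zero_in_subcube: "0 \<in> subcube E"
  by (simp add: subcube_def)

lemma convex_subcube:
  fixes E :: "'n::finite set"
  shows "convex (subcube E)"
proof (rule convexI)
  fix x y :: "real^'n" and u v :: real
  assume *: "x \<in> subcube E" "y \<in> subcube E" "0 \<le> u" "0 \<le> v" "u + v = 1"
  have "u * x $ i + v * y $ i \<le> 1" for i
    using * convex_bound_le [of "x $ i" 1 "y $ i" u v] by (simp add: subcube_def)
  with * show "u *\<^sub>R x + v *\<^sub>R y \<in> subcube E"
    by (auto simp: subcube_def)
qed

lemma compact_subcube: "compact (subcube E)"
proof -
  have eq: "subcube E = cbox 0 (\<chi> i. if i \<in> E then 1 else 0)"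
    unfolding subcube_def set_eq_iff mem_box_cart mem_Collect_eq
    by (intro allI iff_allI) (simp, fastforce)
  show ?thesis unfolding eq by (rule compact_cbox)
qed

lemma carried_by_refl [simp]: "carried_by x x"
  by (simp add: carried_by_def)

lemma unit_interval_step:
  fixes a b c :: real
  assumes "0 \<le> a" "a \<le> 1" "0 \<le> b" "b \<le> 1" "0 \<le> c" "c \<le> 1" "a = 0 \<longrightarrow> b = 0" "a = 1 \<longrightarrow> b = 1"
  shows "\<exists>e>0. \<forall>t. 0 \<le> t \<and> t \<le> e \<longrightarrow> 0 \<le> a + t * (c - b) \<and> a + t * (c - b) \<le> 1"
proof (cases "a = 0 \<or> a = 1")
  case True
  have "0 \<le> a + t * (c - b) \<and> a + t * (c - b) \<le> 1" if t: "0 \<le> t" "t \<le> 1" for t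
  proof -
    have "0 \<le> t * c" "t * c \<le> 1" "0 \<le> t * (1 - c)" "t * (1 - c) \<le> 1"
      using t assms by (auto simp: mult_le_one)
    with True assms show ?thesis by (auto simp: algebra_simps)
  qed
  then show ?thesis by (intro exI[of _ 1]) auto
next
  case False
  have "0 \<le> a + t * (c - b) \<and> a + t * (c - b) \<le> 1" if t: "0 \<le> t" "t \<le> min a (1 - a)" for t
  proof -
    have "\<bar>t * (c - b)\<bar> \<le> t * 1"
      unfolding abs_mult using t assms by (intro mult_mono) auto
    with t show ?thesis by auto
  qed
  with False assms show ?thesis by (intro exI[of _ "min a (1 - a)"]) auto
qed

text \<open>Where \<open>x\<close> is 0 or 1, \<open>y\<close> agrees with it, so a small step along
  \<open>z - y\<close> heads towards \<open>z\<close>; at every other coordinate there is slack.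
  Thus \<open>x\<close> acts as a relative interior point of its cell: directions available at
  \<open>y\<close> are available at \<open>x\<close>.\<close>

lemma subcube_step:
  assumes "x \<in> subcube E" "y \<in> subcube E" "z \<in> subcube E" "carried_by y x"
  obtains e where "e > 0" "x + e *\<^sub>R (z - y) \<in> subcube E"
proof -
  have "\<forall>i. \<exists>e>0. \<forall>t. 0 \<le> t \<and> t \<le> e \<longrightarrow> 0 \<le> x $ i + t * (z $ i - y $ i) \<and> x $ i + t * (z $ i - y $ i) \<le> 1"
    using assms by (intro allI unit_interval_step) (auto simp: subcube_def carried_by_def)
  then obtain e where e: "\<And>i. e i > 0"
    "\<And>i t. 0 \<le> t \<Longrightarrow> t \<le> e i \<Longrightarrow> 0 \<le> x $ i + t * (z $ i - y $ i) \<and> x $ i + t * (z $ i - y $ i) \<le> 1"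
    by metis
  define d where "d = Min (range e)"
  have "d > 0" "\<And>i. d \<le> e i" using e(1) by (auto simp: d_def)
  moreover have "x + d *\<^sub>R (z - y) \<in> subcube E"
    using e(2)[of d] \<open>d > 0\<close> \<open>\<And>i. d \<le> e i\<close> assms by (auto simp: subcube_def)
  ultimately show ?thesis using that by blast
qed

text \<open>Only finitely many cells exist, each given by a set of coordinates fixed to 0 and one
  fixed to 1, and \<open>Q\<close> is the union of those it contains.\<close>

lemma compact_facial:
  fixes Q :: "(real^'n::finite) set"
  assumes "facial E Q"
  shows "compact Q"
proof -
  define cell :: "'n set \<times> 'n set \<Rightarrow> (real^'n) set"
    where "cell = (\<lambda>(A, B). {y \<in> subcube E. (\<forall>i\<in>A. y $ i = 0) \<and> (\<forall>i\<in>B. y $ i = 1)})"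
  define C where "C = {P. cell P \<subseteq> Q}"
  have "Q = (\<Union>P\<in>C. cell P)"
  proof
    show "Q \<subseteq> (\<Union>P\<in>C. cell P)"
    proof
      fix x assume x: "x \<in> Q"
      have "cell ({i. x $ i = 0}, {i. x $ i = 1}) \<subseteq> Q"
        using assms x by (auto simp: cell_def facial_def carried_by_def)
      moreover have "x \<in> cell ({i. x $ i = 0}, {i. x $ i = 1})"
        using assms x by (auto simp: cell_def facial_def)
      ultimately show "x \<in> (\<Union>P\<in>C. cell P)" unfolding C_def by blast
    qed
  qed (auto simp: C_def)
  moreover have "compact (cell P)" for P
  proof -
    obtain A B where P: "P = (A, B)" by force
    have "closed {y::real^'n. (\<forall>i\<in>A. y $ i = 0) \<and> (\<forall>i\<in>B. y $ i = 1)}"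
      unfolding Ball_def
      by (intro closed_Collect_conj closed_Collect_all closed_Collect_imp closed_Collect_eq
          continuous_intros open_Collect_const)
    then have "compact (subcube E \<inter> {y. (\<forall>i\<in>A. y $ i = 0) \<and> (\<forall>i\<in>B. y $ i = 1)})"
      by (rule compact_Int_closed [OF compact_subcube])
    moreover have "cell P = subcube E \<inter> {y. (\<forall>i\<in>A. y $ i = 0) \<and> (\<forall>i\<in>B. y $ i = 1)}"
      by (auto simp: P cell_def)
    ultimately show ?thesis by simp
  qed
  ultimately show ?thesis
    by (metis compact_UN finite)
qed

section \<open>Separation and the kernel of the projection\<close>

lemma V_separated_iff:
  fixes V :: "'n::finite \<Rightarrow> 'a::euclidean_space"
  shows "V_separated V I J \<longleftrightarrow>
    (\<forall>u. cube_proj V u = 0 \<longrightarrow> (\<forall>i. u $ i > 0 \<longrightarrow> i \<in> I - J) \<longrightarrow> (\<forall>i. u $ i < 0 \<longrightarrow> i \<in> J - I) \<longrightarrow> u = 0)"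
    (is "_ \<longleftrightarrow> ?R")
proof
  assume "V_separated V I J"
  then obtain h :: "'a \<Rightarrow> real"
    where h: "linear h" "\<And>i. i \<in> I - J \<Longrightarrow> h (V i) > 0" "\<And>i. i \<in> J - I \<Longrightarrow> h (V i) < 0"
    unfolding V_separated_def by blast
  show ?R
  proof (intro allI impI)
    fix u :: "real^'n"
    assume u: "cube_proj V u = 0" "\<forall>i. u $ i > 0 \<longrightarrow> i \<in> I - J" "\<forall>i. u $ i < 0 \<longrightarrow> i \<in> J - I"
    have nonneg: "0 \<le> u $ i * h (V i)" for i
      using u(2,3)[rule_format, of i] h(2,3)[of i]
      by (cases "u $ i" "0::real" rule: linorder_cases) (auto simp: mult_neg_neg less_imp_le)
    have "(\<Sum>i\<in>UNIV. u $ i * h (V i)) = h (cube_proj V u)"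
      by (simp add: cube_proj_def linear_sum [OF h(1)] linear_cmul [OF h(1)])
    also have "\<dots> = 0" by (simp add: u(1) linear_0 [OF h(1)])
    finally have "\<forall>i\<in>UNIV. u $ i * h (V i) = 0"
      by (subst (asm) sum_nonneg_eq_0_iff) (auto simp: nonneg)
    then show "u = 0"
    proof -
      have "u $ i = 0" for i
      proof (cases "u $ i" "0::real" rule: linorder_cases)
        case less
        with u(3) h(3) \<open>\<forall>i\<in>UNIV. u $ i * h (V i) = 0\<close> show ?thesis
          by (metis UNIV_I less_irrefl mult_eq_0_iff)
      next
        case greater
        with u(2) h(2) \<open>\<forall>i\<in>UNIV. u $ i * h (V i) = 0\<close> show ?thesis
          by (metis UNIV_I less_irrefl mult_eq_0_iff)
      qed
      then show ?thesis by (simp add: vec_eq_iff)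
    qed
  qed
next
  assume R: ?R
  define s :: "'n \<Rightarrow> real" where "s = (\<lambda>i. if i \<in> I - J then 1 else if i \<in> J - I then -1 else 0)"
  \<comment> \<open>The simplex spanned by the signed unit vectors \<open>axis i (s i)\<close> over
    the symmetric difference; the bound by \<open>\<bar>s i\<bar>\<close> kills all other
    coordinates. A hyperplane separating its image from 0 supplies the functional.\<close>
  define D where "D = {x::real^'n. (\<forall>i. 0 \<le> s i * x $ i \<and> \<bar>x $ i\<bar> \<le> \<bar>s i\<bar>) \<and> (\<Sum>i\<in>UNIV. s i * x $ i) = 1}"
  have "closed D"
    unfolding D_def by (intro closed_Collect_conj closed_Collect_all closed_Collect_le closed_Collect_eq continuous_intros)
  moreover have "D \<subseteq> cbox (\<chi> i. -1) (\<chi> i. 1)"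
  proof
    fix x assume "x \<in> D"
    then have "\<bar>x $ i\<bar> \<le> \<bar>s i\<bar>" for i by (simp add: D_def)
    moreover have "\<bar>s i\<bar> \<le> 1" for i by (simp add: s_def)
    ultimately have "\<bar>x $ i\<bar> \<le> 1" for i by (meson order_trans)
    then show "x \<in> cbox (\<chi> i. -1) (\<chi> i. 1)" by (simp add: mem_box_cart abs_le_iff)
  qed
  ultimately have "compact D"
    using bounded_cbox bounded_subset compact_eq_bounded_closed by blast
  have "convex D"
  proof (rule convexI)
    fix x y :: "real^'n" and u v :: real
    assume *: "x \<in> D" "y \<in> D" "0 \<le> u" "0 \<le> v" "u + v = 1"
    have "0 \<le> s i * (u * x $ i + v * y $ i)" for i
    proof -
      have "0 \<le> u * (s i * x $ i) + v * (s i * y $ i)"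
        using * by (auto simp: D_def)
      then show ?thesis by (simp add: algebra_simps)
    qed
    moreover have "\<bar>u * x $ i + v * y $ i\<bar> \<le> \<bar>s i\<bar>" for i
    proof -
      have "\<bar>u * x $ i + v * y $ i\<bar> \<le> u * \<bar>x $ i\<bar> + v * \<bar>y $ i\<bar>"
        using * by (metis abs_mult abs_of_nonneg abs_triangle_ineq)
      also have "\<dots> \<le> \<bar>s i\<bar>" using * by (intro convex_bound_le) (auto simp: D_def)
      finally show ?thesis .
    qed
    moreover have "(\<Sum>i\<in>UNIV. s i * (u * x $ i + v * y $ i)) = u * (\<Sum>i\<in>UNIV. s i * x $ i) + v * (\<Sum>i\<in>UNIV. s i * y $ i)"
      by (simp add: sum_distrib_left sum.distrib algebra_simps)
    ultimately show "u *\<^sub>R x + v *\<^sub>R y \<in> D"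
      using * by (simp add: D_def)
  qed
  have "0 \<notin> cube_proj V ` D"
  proof
    assume "0 \<in> cube_proj V ` D"
    then obtain u where u: "u \<in> D" "cube_proj V u = 0" by auto
    have "0 \<le> s i * u $ i" "\<bar>u $ i\<bar> \<le> \<bar>s i\<bar>" for i using u by (auto simp: D_def)
    note s = this
    have "u $ i > 0 \<longrightarrow> i \<in> I - J" "u $ i < 0 \<longrightarrow> i \<in> J - I" for i
      using s[of i] by (auto simp: s_def split: if_split_asm)
    with R u(2) have "u = 0" by blast
    with u(1) show False by (simp add: D_def)
  qed
  moreover have "convex (cube_proj V ` D)"
    using \<open>convex D\<close> linear_cube_proj by (rule convex_linear_image [rotated])
  moreover have "closed (cube_proj V ` D)"
    by (intro compact_imp_closed compact_continuous_image \<open>compact D\<close> continuous_on_cube_proj)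
  ultimately obtain a b where ab: "0 < b" "\<And>x. x \<in> cube_proj V ` D \<Longrightarrow> a \<bullet> x > b"
    using separating_hyperplane_closed_0 [of "cube_proj V ` D"] by blast
  have ax: "axis i (s i) \<in> D" if "s i \<noteq> 0" for i
  proof -
    have "(\<Sum>j\<in>UNIV. s j * axis i (s i) $ j) = (\<Sum>j\<in>UNIV. if j = i then s j * s i else 0)"
      by (rule sum.cong) (auto simp: axis_def)
    moreover have "s i * s i = 1" using that by (auto simp: s_def split: if_splits)
    ultimately show ?thesis
      by (auto simp: D_def axis_def)
  qed
  have pos: "0 < a \<bullet> (s i *\<^sub>R V i)" if "s i \<noteq> 0" for i
  proof -
    have "cube_proj V (axis i (s i)) \<in> cube_proj V ` D" using ax[OF that] by blast
    then show ?thesis using ab by fastforce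
  qed
  have "linear (\<lambda>x. a \<bullet> x)" by (rule linearI) (simp_all add: inner_add_right)
  moreover have "a \<bullet> V i > 0" if "i \<in> I - J" for i using pos[of i] that by (auto simp: s_def)
  moreover have "a \<bullet> V i < 0" if "i \<in> J - I" for i using pos[of i] that by (auto simp: s_def)
  ultimately show "V_separated V I J" unfolding V_separated_def by blast
qed

section \<open>Sections, deletion and contraction\<close>

lemma cubical_sectionD:
  assumes "cubical_section E V Q"
  shows "facial E Q" "inj_on (cube_proj V) Q" "cube_proj V ` Q = cube_proj V ` subcube E"
    "Q \<subseteq> subcube E" "\<And>x y. x \<in> Q \<Longrightarrow> y \<in> Q \<Longrightarrow> cube_proj V x = cube_proj V y \<Longrightarrow> x = y"
    "\<And>x y. x \<in> Q \<Longrightarrow> y \<in> subcube E \<Longrightarrow> carried_by y x \<Longrightarrow> y \<in> Q"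
  using assms by (auto simp: cubical_section_def facial_def inj_on_def)

lemma cubical_section_cover:
  assumes "cubical_section E V Q" "y \<in> subcube E"
  obtains x where "x \<in> Q" "cube_proj V x = cube_proj V y"
proof -
  have "cube_proj V y \<in> cube_proj V ` Q" using cubical_sectionD(3)[OF assms(1)] assms(2) by blast
  with that show thesis by force
qed

lemma facial_set_coord:
  assumes "facial E Q" "x \<in> Q" "0 < x $ n" "x $ n < 1" "0 \<le> t" "t \<le> 1"
  shows "set_coord n t x \<in> Q"
proof -
  have x: "x \<in> subcube E" using assms by (auto simp: facial_def)
  with assms have "n \<in> E" by (auto simp: subcube_def)
  with x assms have "set_coord n t x \<in> subcube E"
    by (intro set_coord_in_subcube)
  moreover have "carried_by (set_coord n t x) x" using assms by (auto simp: carried_by_def)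
  ultimately show ?thesis using assms by (auto simp: facial_def)
qed

section \<open>Lifting lines of the zonotope to a section\<close>

lemma cubical_section_lift:
  assumes "cubical_section E V Q"
  obtains g where "\<And>x. x \<in> Q \<Longrightarrow> g (cube_proj V x) = x"
    "\<And>x. x \<in> subcube E \<Longrightarrow> g (cube_proj V x) \<in> Q"
    "\<And>x. x \<in> subcube E \<Longrightarrow> cube_proj V (g (cube_proj V x)) = cube_proj V x"
    "continuous_on (cube_proj V ` subcube E) g"
proof
  note sec = cubical_sectionD[OF assms]
  let ?g = "inv_into Q (cube_proj V)"
  show *: "?g (cube_proj V x) = x" if "x \<in> Q" for x
    using sec(2) that by simp
  show "continuous_on (cube_proj V ` subcube E) ?g"
    unfolding sec(3)[symmetric]
    by (rule continuous_on_inv [OF continuous_on_cube_proj compact_facial [OF sec(1)]]) (use * in blast)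
  show "?g (cube_proj V x) \<in> Q" "cube_proj V (?g (cube_proj V x)) = cube_proj V x" if "x \<in> subcube E" for x
    using that sec(3) by (metis imageI inv_into_into) (metis f_inv_into_f imageI sec(3) that)
qed

lemma coord_path:
  assumes sec: "cubical_section E V Q" and "x \<in> Q" "y \<in> Q"
    and s: "cube_proj V y = cube_proj V x + s *\<^sub>R V n" "0 \<le> s"
  obtains z where "z 0 = x" "z s = y"
    "\<And>r. 0 \<le> r \<Longrightarrow> r \<le> s \<Longrightarrow> z r \<in> Q"
    "\<And>r. 0 \<le> r \<Longrightarrow> r \<le> s \<Longrightarrow> cube_proj V (z r) = cube_proj V x + r *\<^sub>R V n"
    "continuous_on {0..s} (\<lambda>r. z r $ n)"
proof (rule cubical_section_lift [OF sec])
  fix g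
  assume g: "\<And>x. x \<in> Q \<Longrightarrow> g (cube_proj V x) = x"
    "\<And>x. x \<in> subcube E \<Longrightarrow> g (cube_proj V x) \<in> Q"
    "\<And>x. x \<in> subcube E \<Longrightarrow> cube_proj V (g (cube_proj V x)) = cube_proj V x"
    "continuous_on (cube_proj V ` subcube E) g"
  \<comment> \<open>The segment only certifies that the line stays in the zonotope; the path itself
    is the lift by \<open>g\<close>. For \<open>s = 0\<close> the quotient is 0 and the segment is
    constantly \<open>x\<close>.\<close>
  define l where "l = (\<lambda>r. x + (r / s) *\<^sub>R (y - x))"
  have xy: "x \<in> subcube E" "y \<in> subcube E" using assms cubical_sectionD(4) by blast+
  have l: "l r \<in> subcube E" if "0 \<le> r" "r \<le> s" for r
  proof (cases "s = 0")
    case False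
    then have "(1 - r / s) *\<^sub>R x + (r / s) *\<^sub>R y \<in> subcube E"
      using convexD_alt[OF convex_subcube xy, of "r / s"] that s(2) by simp
    then show ?thesis by (simp add: l_def algebra_simps)
  qed (simp add: l_def xy)
  have pl: "cube_proj V (l r) = cube_proj V x + r *\<^sub>R V n" if "0 \<le> r" "r \<le> s" for r
    using that s by (cases "s = 0") (simp_all add: l_def)
  define z where "z = (\<lambda>r. g (cube_proj V x + r *\<^sub>R V n))"
  show thesis
  proof
    show "z 0 = x" "z s = y" using g(1) assms by (simp_all add: z_def s(1)[symmetric])
    show "z r \<in> Q" "cube_proj V (z r) = cube_proj V x + r *\<^sub>R V n" if "0 \<le> r" "r \<le> s" for r
      using g(2,3)[OF l[OF that]] that by (simp_all add: z_def pl)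
    have "continuous_on {0..s} z"
      unfolding z_def
      by (rule continuous_on_compose2 [OF g(4)])
         (auto intro!: continuous_intros, metis imageI l pl)
    then show "continuous_on {0..s} (\<lambda>r. z r $ n)"
      by (intro continuous_intros)
  qed
qed

text \<open>Inside a cell with free coordinate n the section moves with unit speed in that coordinate,
  so a last passage through a value strictly between y n and x n is impossible.\<close>

lemma coord_monotone:
  assumes sec: "cubical_section E V Q" and "x \<in> Q" "y \<in> Q"
    and s: "cube_proj V y = cube_proj V x + s *\<^sub>R V n" "0 \<le> s"
  shows "x $ n \<le> y $ n"
proof (rule ccontr)
  assume less: "\<not> x $ n \<le> y $ n"
  note secD = cubical_sectionD[OF sec]
  obtain z where z: "z 0 = x" "z s = y"
    "\<And>r. 0 \<le> r \<Longrightarrow> r \<le> s \<Longrightarrow> z r \<in> Q"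
    "\<And>r. 0 \<le> r \<Longrightarrow> r \<le> s \<Longrightarrow> cube_proj V (z r) = cube_proj V x + r *\<^sub>R V n"
    "continuous_on {0..s} (\<lambda>r. z r $ n)"
    using coord_path[OF assms] by blast
  obtain c where c: "y $ n < c" "c < x $ n" using less dense by (auto simp: not_le)
  moreover have "0 \<le> y $ n" "x $ n \<le> 1" using assms secD(4) by (auto simp: subcube_def)
  ultimately have c01: "0 < c" "c < 1" by linarith+
  define K where "K = {r \<in> {0..s}. z r $ n = c}"
  have "closed K"
    unfolding K_def by (rule continuous_closed_preimage_constant [OF z(5)]) simp
  then have "compact ({0..s} \<inter> K)" by (rule compact_Int_closed [OF compact_Icc])
  then have "compact K" by (rule back_subst[of compact]) (auto simp: K_def)
  moreover have "\<exists>r\<ge>0. r \<le> s \<and> z r $ n = c"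
    using IVT2'[of "\<lambda>r. z r $ n" s c 0] z c s(2) by auto
  then have "K \<noteq> {}" by (auto simp: K_def)
  ultimately obtain r where r: "r \<in> K" "\<And>q. q \<in> K \<Longrightarrow> q \<le> r"
    using compact_attains_sup by metis
  have "r < s" "0 \<le> r" "z r $ n = c"
    using r(1) z(2) c by (auto simp: K_def less_le)
  \<comment> \<open>Both limits matter: the raised coordinate must not exceed 1, nor the time
    \<open>r + d\<close> exceed \<open>s\<close>.\<close>
  define d where "d = min (1 - c) (s - r)"
  have d: "0 < d" "c + d \<le> 1" "r + d \<le> s" using \<open>r < s\<close> c01 by (auto simp: d_def)
  have "set_coord n (c + d) (z r) \<in> Q"
    using c01 d \<open>r < s\<close> \<open>0 \<le> r\<close> \<open>z r $ n = c\<close> z(3) by (intro facial_set_coord[OF secD(1)]) auto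
  moreover have "cube_proj V (set_coord n (c + d) (z r)) = cube_proj V (z (r + d))"
    using d \<open>r < s\<close> \<open>0 \<le> r\<close> \<open>z r $ n = c\<close> z(4) by (simp add: cube_proj_set_coord scaleR_left_distrib)
  ultimately have "z (r + d) = set_coord n (c + d) (z r)"
    using secD(5) z(3)[of "r + d"] d \<open>0 \<le> r\<close> by force
  then have "z (r + d) $ n \<ge> c" using d by simp
  moreover have "continuous_on {r + d..s} (\<lambda>r. z r $ n)"
    by (rule continuous_on_subset [OF z(5)]) (use d \<open>0 \<le> r\<close> in auto)
  ultimately obtain q where "r + d \<le> q" "q \<le> s" "z q $ n = c"
    using IVT2'[of "\<lambda>r. z r $ n" s c "r + d"] z(2) c d by auto
  with d \<open>0 \<le> r\<close> have "q \<in> K" "r < q" by (auto simp: K_def)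
  with r(2) show False by fastforce
qed

text \<open>At height 1/2 the lifted path from \<open>x\<close> to \<open>y\<close> is inside a cell
  with free coordinate \<open>n\<close>, which contains a full edge in that direction. If this
  happened at a time \<open>r\<close> other than 1/2, the edge would pass through \<open>x\<close>
  at height \<open>1/2 - r > 0\<close> or through \<open>y\<close> at height
  \<open>3/2 - r < 1\<close>. So the edge is the one joining \<open>x\<close> to
  \<open>y\<close>.\<close>

lemma section_edge:
  assumes sec: "cubical_section E V Q" and "x \<in> Q" "y \<in> Q"
    and p: "cube_proj V y = cube_proj V x + V n" and n: "x $ n = 0" "y $ n = 1"
    and t: "0 \<le> t" "t \<le> 1"
  shows "set_coord n t x \<in> Q"
proof -
  note secD = cubical_sectionD[OF sec]
  obtain z where z: "z 0 = x" "z 1 = y"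
    "\<And>r. 0 \<le> r \<Longrightarrow> r \<le> 1 \<Longrightarrow> z r \<in> Q"
    "\<And>r. 0 \<le> r \<Longrightarrow> r \<le> 1 \<Longrightarrow> cube_proj V (z r) = cube_proj V x + r *\<^sub>R V n"
    "continuous_on {0..1} (\<lambda>r. z r $ n)"
    using coord_path[OF sec assms(2,3), of 1 n] p by auto
  obtain r where r: "0 \<le> r" "r \<le> 1" "z r $ n = 1/2"
    using IVT'[of "\<lambda>r. z r $ n" 0 "1/2" 1] z n by auto
  have in_Q: "set_coord n q (z r) \<in> Q" if "0 \<le> q" "q \<le> 1" for q
    using r that z(3) by (intro facial_set_coord[OF secD(1)]) auto
  have proj: "cube_proj V (set_coord n q (z r)) = cube_proj V x + (r + q - 1/2) *\<^sub>R V n" for q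
    using r z(4) by (simp add: cube_proj_set_coord algebra_simps)
  have "r = 1/2"
  proof (cases "r \<le> 1/2")
    case True
    have "set_coord n (1/2 - r) (z r) = x"
      using secD(5)[OF in_Q assms(2)] proj[of "1/2 - r"] r True by simp
    then have "set_coord n (1/2 - r) (z r) $ n = x $ n" by (rule arg_cong)
    then show ?thesis using n by simp
  next
    case False
    have "set_coord n (3/2 - r) (z r) = y"
      using secD(5)[OF in_Q assms(3)] proj[of "3/2 - r"] r False p by simp
    then have "set_coord n (3/2 - r) (z r) $ n = y $ n" by (rule arg_cong)
    then show ?thesis using n by simp
  qed
  then have "set_coord n 0 (z r) = x"
    using secD(5)[OF in_Q assms(2)] proj[of 0] by simp
  then have "set_coord n t x = set_coord n t (z r)" by auto
  with in_Q t show ?thesis by simp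
qed

section \<open>Deletion\<close>

text \<open>Points whose flattenings have the same image differ by a multiple of \<open>V n\<close>.
  Unless their heights are 0 and 1, one can be moved inside its cell to the height of the other, and
  injectivity on \<open>Q\<close> identifies them; \<open>section_edge\<close> covers the remaining
  case.\<close>

lemma deletion_section:
  assumes sec: "cubical_section E V Q" and n: "n \<in> E"
  shows "cubical_section (E - {n}) V (set_coord n 0 ` Q)"
  unfolding cubical_section_def
proof (intro conjI)
  note secD = cubical_sectionD[OF sec]
  show "facial (E - {n}) (set_coord n 0 ` Q)"
    unfolding facial_def
  proof (intro conjI ballI impI)
    show "set_coord n 0 ` Q \<subseteq> subcube (E - {n})" using secD(4) set_coord_0_in_subcube by blast
    fix x y assume "x \<in> set_coord n 0 ` Q" and y: "y \<in> subcube (E - {n})" "carried_by y x"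
    then obtain w where w: "w \<in> Q" "x = set_coord n 0 w" by blast
    have "set_coord n (w $ n) y \<in> Q"
    proof (rule secD(6)[OF w(1)])
      show "set_coord n (w $ n) y \<in> subcube E"
        using w secD(4) n y by (intro set_coord_in_subcube_insert) (auto simp: subcube_def)
      show "carried_by (set_coord n (w $ n) y) w"
        using y(2) by (auto simp: carried_by_def w split: if_splits)
    qed
    moreover have "set_coord n 0 (set_coord n (w $ n) y) = y"
      using y(1) by (simp add: subcube_def)
    ultimately show "y \<in> set_coord n 0 ` Q" by (metis imageI)
  qed
  have le: "set_coord n 0 x = set_coord n 0 y"
    if xy: "x \<in> Q" "y \<in> Q" "cube_proj V (set_coord n 0 x) = cube_proj V (set_coord n 0 y)" "x $ n \<le> y $ n" for x y
  proof -
    have p: "cube_proj V y = cube_proj V x + (y $ n - x $ n) *\<^sub>R V n"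
      using xy(3) by (simp add: cube_proj_set_coord algebra_simps)
    have x01: "0 \<le> x $ n" "y $ n \<le> 1" using xy secD(4) by (auto simp: subcube_def)
    consider "x $ n = y $ n" | "x $ n = 0" "y $ n = 1" | "0 < x $ n" "x $ n < 1" | "0 < y $ n" "y $ n < 1"
      using x01 xy(4) by fastforce
    then have "set_coord n (y $ n) x \<in> Q \<or> set_coord n (x $ n) y \<in> Q"
    proof cases
      case 1 then show ?thesis using xy by auto
    next
      case 2 then show ?thesis using section_edge[OF sec xy(1,2), of n 1] p by auto
    next
      case 3
      then show ?thesis using facial_set_coord[OF secD(1) xy(1)] x01 xy by auto
    next
      case 4
      then show ?thesis using facial_set_coord[OF secD(1) xy(2)] x01 xy by auto
    qed
    then have "set_coord n (y $ n) x = y \<or> set_coord n (x $ n) y = x"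
      using secD(5) xy p by (auto simp: cube_proj_set_coord algebra_simps)
    then show ?thesis by (metis set_coord_set_coord)
  qed
  show "inj_on (cube_proj V) (set_coord n 0 ` Q)"
    by (rule inj_onI) (use le in \<open>smt (verit) imageE linear\<close>)
  show "cube_proj V ` set_coord n 0 ` Q = cube_proj V ` subcube (E - {n})"
  proof
    show "cube_proj V ` set_coord n 0 ` Q \<subseteq> cube_proj V ` subcube (E - {n})"
      using secD(4) set_coord_0_in_subcube by blast
    show "cube_proj V ` subcube (E - {n}) \<subseteq> cube_proj V ` set_coord n 0 ` Q"
    proof
      fix w assume "w \<in> cube_proj V ` subcube (E - {n})"
      then obtain c where c: "c \<in> subcube (E - {n})" "w = cube_proj V c" by blast
      \<comment> \<open>Compare lifts \<open>x\<close> of \<open>w\<close> and \<open>y\<close> of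
        \<open>w + V n\<close>. If \<open>x\<close> has height 0 or \<open>y\<close> height 1,
        flattening it yields \<open>w\<close>. Otherwise coordinate \<open>n\<close> is free at
        \<open>x\<close>; raised to 1, the point still lies before \<open>y\<close> in direction
        \<open>V n\<close>, so monotonicity forces \<open>y\<close> to height 1 after all.\<close>
      have "set_coord n t c \<in> subcube E" if "0 \<le> t" "t \<le> 1" for t
        using that c n by (intro set_coord_in_subcube_insert)
      then have "\<exists>x\<in>Q. cube_proj V x = w + t *\<^sub>R V n" if "0 \<le> t" "t \<le> 1" for t
        using secD(3) that c(1) unfolding c(2)
        by (smt (verit) DiffD2 cube_proj_set_coord image_iff insertI1 mem_Collect_eq subcube_def)
      from this[of 0] this[of 1]
      obtain x y where xy: "x \<in> Q" "y \<in> Q" "cube_proj V x = w" "cube_proj V y = w + V n"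
        by auto
      have x01: "0 \<le> x $ n" "x $ n \<le> 1" "y $ n \<le> 1" using xy secD(4) by (auto simp: subcube_def)
      show "w \<in> cube_proj V ` set_coord n 0 ` Q"
      proof (cases "x $ n = 0 \<or> y $ n = 1")
        case True
        moreover have "cube_proj V (set_coord n 0 x) = w" if "x $ n = 0" using that xy by simp
        moreover have "cube_proj V (set_coord n 0 y) = w" if "y $ n = 1"
          using that xy by (simp add: cube_proj_set_coord)
        ultimately show ?thesis using xy by blast
      next
        case False
        have "x $ n \<le> y $ n" using coord_monotone[OF sec xy(1,2), of 1 n] xy by simp
        with False x01 have "0 < x $ n" "x $ n < 1" by auto
        then have "set_coord n 1 x \<in> Q" using facial_set_coord[OF secD(1) xy(1)] by simp
        moreover have "cube_proj V y = cube_proj V (set_coord n 1 x) + x $ n *\<^sub>R V n"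
          using xy by (simp add: cube_proj_set_coord algebra_simps)
        ultimately have "1 \<le> y $ n" using coord_monotone[OF sec _ xy(2), of "set_coord n 1 x" "x $ n" n] x01 by simp
        with False x01 show ?thesis by simp
      qed
    qed
  qed
qed

text \<open>Over a flattened vertex \<open>Q\<close> has a point of height 0, 1 or in between, and
  in the last case its cell contains the end at height 0.\<close>

lemma vertex_labels_deletion:
  assumes sec: "cubical_section E V Q"
  shows "vertex_labels (set_coord n 0 ` Q) = (\<lambda>I. I - {n}) ` vertex_labels Q"
proof (intro equalityI subsetI)
  note secD = cubical_sectionD[OF sec]
  fix I assume "I \<in> vertex_labels (set_coord n 0 ` Q)"
  then obtain x where x: "x \<in> Q" "cube_vertex I = set_coord n 0 x" by (auto simp: vertex_labels_def)
  have xi: "x $ i = (if i \<in> I then 1 else 0)" if "i \<noteq> n" for i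
    using arg_cong[OF x(2), of "\<lambda>v. v $ i"] that by simp
  have nI: "n \<notin> I" using arg_cong[OF x(2), of "\<lambda>v. v $ n"] by (simp split: if_splits)
  have "0 \<le> x $ n" "x $ n \<le> 1" using x secD(4) by (auto simp: subcube_def)
  then consider "x $ n = 0" | "x $ n = 1" | "0 < x $ n" "x $ n < 1" by fastforce
  then show "I \<in> (\<lambda>I. I - {n}) ` vertex_labels Q"
  proof cases
    case 1
    then have "I \<in> vertex_labels Q" using x by (simp add: vertex_labels_def)
    then show ?thesis using nI by (metis Diff_empty Diff_insert0 image_eqI)
  next
    case 2
    then have "x = cube_vertex (insert n I)" using xi by (simp add: vec_eq_iff) metis
    then have "insert n I \<in> vertex_labels Q" using x by (simp add: vertex_labels_def)
    then show ?thesis using nI by (metis Diff_insert_absorb image_eqI)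
  next
    case 3
    then have "I \<in> vertex_labels Q"
      using facial_set_coord[OF secD(1) x(1), of n 0] x(2) by (simp add: vertex_labels_def)
    then show ?thesis using nI by (metis Diff_empty Diff_insert0 image_eqI)
  qed
next
  fix I assume "I \<in> (\<lambda>I. I - {n}) ` vertex_labels Q"
  then obtain J where J: "cube_vertex J \<in> Q" "I = J - {n}" by (auto simp: vertex_labels_def)
  then have "cube_vertex I = set_coord n 0 (cube_vertex J)" by (simp add: vec_eq_iff)
  with J show "I \<in> vertex_labels (set_coord n 0 ` Q)" by (auto simp: vertex_labels_def)
qed

section \<open>Contraction\<close>

text \<open>\<open>contraction V n\<close> is \<open>V\<close> followed by the orthogonal projection
  along \<open>V n\<close>, which forgets exactly the multiples of \<open>V n\<close>.\<close>

lemma contraction_eq_iff: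
  "cube_proj (contraction V n) x = cube_proj (contraction V n) y \<longleftrightarrow>
    (\<exists>s. cube_proj V x = cube_proj V y + s *\<^sub>R V n)"
proof -
  let ?c = "\<lambda>v. (v \<bullet> V n) / (V n \<bullet> V n)"
  have W: "cube_proj (contraction V n) x = cube_proj V x - ?c (cube_proj V x) *\<^sub>R V n" for x
    by (simp add: cube_proj_def contraction_def scaleR_diff_right sum_subtractf
        inner_sum_left sum_divide_distrib scaleR_left.sum)
  show ?thesis
  proof
    assume *: "cube_proj (contraction V n) x = cube_proj (contraction V n) y"
    then have "cube_proj V x = cube_proj V y + (?c (cube_proj V x) - ?c (cube_proj V y)) *\<^sub>R V n"
      unfolding W by (simp add: algebra_simps)
    then show "\<exists>s. cube_proj V x = cube_proj V y + s *\<^sub>R V n" by blast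
  next
    assume "\<exists>s. cube_proj V x = cube_proj V y + s *\<^sub>R V n"
    then obtain s where s: "cube_proj V x = cube_proj V y + s *\<^sub>R V n" ..
    show "cube_proj (contraction V n) x = cube_proj (contraction V n) y"
      unfolding W s by (cases "V n = 0") (simp_all add: inner_add_left add_divide_distrib scaleR_left_distrib)
  qed
qed

lemma contraction_eq_0_iff:
  "cube_proj (contraction V n) x = 0 \<longleftrightarrow> (\<exists>s. cube_proj V x = s *\<^sub>R V n)"
  using contraction_eq_iff[of V n x 0] by simp

text \<open>The line through the image of \<open>c\<close> leaves the zonotope at two ends;
  \<open>b = 1\<close> selects the far one in direction \<open>V n\<close>, \<open>b = 0\<close> the
  near one, with sign \<open>2 * b - 1\<close>. The lift of an end has height \<open>b\<close>,
  since otherwise changing coordinate \<open>n\<close> to \<open>b\<close> would lead further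
  out.\<close>

lemma section_line_end:
  assumes sec: "cubical_section E V Q" and n: "n \<in> E" "V n \<noteq> 0" and c: "c \<in> subcube E"
    and b: "b = 0 \<or> b = (1::real)"
  obtains s x where "0 \<le> (2 * b - 1) * s" "x \<in> Q" "x $ n = b" "cube_proj V x = cube_proj V c + s *\<^sub>R V n"
proof -
  note secD = cubical_sectionD[OF sec]
  define K where "K = {x \<in> subcube E. \<exists>s. cube_proj V x = cube_proj V c + s *\<^sub>R V n}"
  define f where "f = (\<lambda>x. (2 * b - 1) * (cube_proj V x \<bullet> V n))"
  have "K = subcube E \<inter> {x. cube_proj (contraction V n) x = cube_proj (contraction V n) c}"
    by (auto simp: K_def contraction_eq_iff)
  moreover have "closed {x. cube_proj (contraction V n) x = cube_proj (contraction V n) c}"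
    by (intro closed_Collect_eq continuous_on_cube_proj continuous_on_const)
  ultimately have "compact K" using compact_Int_closed[OF compact_subcube] by metis
  moreover have "c \<in> K" using c by (auto simp: K_def intro: exI[of _ 0])
  moreover have "continuous_on K f"
    unfolding f_def by (intro continuous_intros)
  ultimately obtain y where y: "y \<in> K" "\<And>z. z \<in> K \<Longrightarrow> f z \<le> f y"
    using continuous_attains_sup[of K f] by blast
  then obtain s where s: "cube_proj V y = cube_proj V c + s *\<^sub>R V n" by (auto simp: K_def)
  have pos: "V n \<bullet> V n > 0" using n by simp
  have "0 \<le> ((2 * b - 1) * s) * (V n \<bullet> V n)"
    using y(2)[OF \<open>c \<in> K\<close>] by (simp add: f_def s inner_add_left algebra_simps)
  then have "0 \<le> (2 * b - 1) * s" using pos by (metis mult_le_cancel_right_pos mult_zero_left)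
  obtain x where x: "x \<in> Q" "cube_proj V x = cube_proj V y"
    using secD(3) y(1) by (metis (no_types, lifting) K_def imageE image_eqI mem_Collect_eq)
  have "x \<in> subcube E" using x secD(4) by blast
  have "set_coord n b x \<in> K"
    using set_coord_in_subcube[OF \<open>x \<in> subcube E\<close> n(1), of b] x(2) s b
    by (auto simp: K_def cube_proj_set_coord algebra_simps intro!: exI[of _ "s + (b - x $ n)"])
  from y(2)[OF this] have "((2 * b - 1) * (b - x $ n)) * (V n \<bullet> V n) \<le> 0"
    using x(2) by (simp add: f_def cube_proj_set_coord inner_add_left algebra_simps)
  then have "(2 * b - 1) * (b - x $ n) \<le> 0" using pos by (metis mult_le_cancel_right_pos mult_zero_left)
  moreover have "0 \<le> x $ n" "x $ n \<le> 1" using \<open>x \<in> subcube E\<close> by (simp_all add: subcube_def)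
  ultimately have "x $ n = b" using b by auto
  with that \<open>0 \<le> (2 * b - 1) * s\<close> x s show thesis by simp
qed

definition contract_section :: "'n::finite \<Rightarrow> (real^'n) set \<Rightarrow> (real^'n) set" where
  "contract_section n Q = {x. x $ n = 0 \<and> (\<forall>t. 0 \<le> t \<longrightarrow> t \<le> 1 \<longrightarrow> set_coord n t x \<in> Q)}"

text \<open>Let \<open>x\<close> and \<open>y\<close> be prism bases on one line, \<open>y\<close>
  ahead by \<open>s\<close> times \<open>V n\<close>. If \<open>s \<ge> 1\<close>, the top of the
  edge over \<open>x\<close> does not come after \<open>y\<close>, which has height 0, against
  monotonicity; if \<open>s < 1\<close>, \<open>y\<close> lies on that edge, so
  \<open>s = 0\<close>. For surjectivity, the ends of each line have heights 0 and 1, and the lift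
  at height 1/2 is in a prism.\<close>

lemma contraction_section:
  assumes sec: "cubical_section E V Q" and n: "n \<in> E" "V n \<noteq> 0"
  shows "cubical_section (E - {n}) (contraction V n) (contract_section n Q)"
  unfolding cubical_section_def
proof (intro conjI)
  note secD = cubical_sectionD[OF sec]
  have sub: "contract_section n Q \<subseteq> subcube (E - {n})"
  proof
    fix x assume x: "x \<in> contract_section n Q"
    then have "set_coord n 0 x \<in> Q" "x $ n = 0" unfolding contract_section_def by auto
    then show "x \<in> subcube (E - {n})" using secD(4) by (auto simp: subcube_def)
  qed
  show "facial (E - {n}) (contract_section n Q)"
    unfolding facial_def
  proof (intro conjI ballI impI sub)
    fix x y assume x: "x \<in> contract_section n Q" and y: "y \<in> subcube (E - {n})" "carried_by y x"
    have "set_coord n t y \<in> Q" if t: "0 \<le> t" "t \<le> 1" for t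
    proof (rule secD(6))
      show "set_coord n t x \<in> Q" using x t by (simp add: contract_section_def)
      show "set_coord n t y \<in> subcube E" by (rule set_coord_in_subcube_insert[OF y(1) n(1) t])
      show "carried_by (set_coord n t y) (set_coord n t x)" using y(2) by (simp add: carried_by_def)
    qed
    then show "y \<in> contract_section n Q" using y(1) by (simp add: contract_section_def subcube_def)
  qed
  have inj: "x = y" if xy: "x \<in> contract_section n Q" "y \<in> contract_section n Q"
    "cube_proj V y = cube_proj V x + s *\<^sub>R V n" "0 \<le> s" for x y s
  proof -
    have "x \<in> Q" "y \<in> Q" "y $ n = 0" "x $ n = 0" using xy(1,2) by (auto simp: contract_section_def dest: spec[of _ 0])
    have "s < 1"
    proof (rule ccontr)
      assume "\<not> s < 1"
      moreover have "set_coord n 1 x \<in> Q" using xy by (simp add: contract_section_def)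
      moreover have "cube_proj V y = cube_proj V (set_coord n 1 x) + (s - 1) *\<^sub>R V n"
        using xy(3) \<open>x $ n = 0\<close> by (simp add: cube_proj_set_coord algebra_simps)
      ultimately have "set_coord n 1 x $ n \<le> y $ n"
        by (intro coord_monotone[OF sec _ \<open>y \<in> Q\<close>]) auto
      with \<open>y $ n = 0\<close> show False by simp
    qed
    then have "set_coord n s x \<in> Q" using xy by (simp add: contract_section_def)
    then have "y = set_coord n s x"
      using secD(5)[OF \<open>y \<in> Q\<close>] xy(3) \<open>x $ n = 0\<close> by (simp add: cube_proj_set_coord)
    moreover from this have "s = 0" using \<open>y $ n = 0\<close> by simp
    ultimately show ?thesis using \<open>x $ n = 0\<close> by simp
  qed
  show "inj_on (cube_proj (contraction V n)) (contract_section n Q)"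
  proof (rule inj_onI)
    fix x y
    assume xy: "x \<in> contract_section n Q" "y \<in> contract_section n Q"
      "cube_proj (contraction V n) x = cube_proj (contraction V n) y"
    then obtain s where s: "cube_proj V x = cube_proj V y + s *\<^sub>R V n"
      by (auto simp: contraction_eq_iff)
    then have s': "cube_proj V y = cube_proj V x + (- s) *\<^sub>R V n" by simp
    show "x = y"
    proof (cases "0 \<le> s")
      case True
      then show ?thesis using inj[OF xy(2,1) s] by simp
    next
      case False
      then show ?thesis using inj[OF xy(1,2) s'] by simp
    qed
  qed
  show "cube_proj (contraction V n) ` contract_section n Q = cube_proj (contraction V n) ` subcube (E - {n})"
  proof
    show "cube_proj (contraction V n) ` contract_section n Q \<subseteq> cube_proj (contraction V n) ` subcube (E - {n})"
      using sub by blast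
    show "cube_proj (contraction V n) ` subcube (E - {n}) \<subseteq> cube_proj (contraction V n) ` contract_section n Q"
    proof (clarsimp)
      fix c assume "c \<in> subcube (E - {n})"
      then have c: "c \<in> subcube E" using subcube_mono[of "E - {n}" E] by auto
      obtain s x where x: "s \<le> 0" "x \<in> Q" "x $ n = 0" "cube_proj V x = cube_proj V c + s *\<^sub>R V n"
        using section_line_end[OF sec n c, of 0] by auto
      obtain s' y where y: "0 \<le> s'" "y \<in> Q" "y $ n = 1" "cube_proj V y = cube_proj V c + s' *\<^sub>R V n"
        using section_line_end[OF sec n c, of 1] by auto
      have "cube_proj V y = cube_proj V x + (s' - s) *\<^sub>R V n" using x y by (simp add: algebra_simps)
      then obtain z where z: "z 0 = x" "z (s' - s) = y"
        "\<And>r. 0 \<le> r \<Longrightarrow> r \<le> s' - s \<Longrightarrow> z r \<in> Q"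
        "\<And>r. 0 \<le> r \<Longrightarrow> r \<le> s' - s \<Longrightarrow> cube_proj V (z r) = cube_proj V x + r *\<^sub>R V n"
        "continuous_on {0..s' - s} (\<lambda>r. z r $ n)"
        using coord_path[OF sec x(2) y(2), of "s' - s" n] x(1) y(1) by auto
      obtain r where r: "0 \<le> r" "r \<le> s' - s" "z r $ n = 1/2"
        using IVT'[of "\<lambda>r. z r $ n" 0 "1/2" "s' - s"] z x(1,3) y(1,3) by auto
      have "set_coord n t (z r) \<in> Q" if "0 \<le> t" "t \<le> 1" for t
        using facial_set_coord[OF secD(1) z(3)[OF r(1,2)], of n t] r(3) that by simp
      then have "set_coord n 0 (z r) \<in> contract_section n Q" by (simp add: contract_section_def)
      moreover have "cube_proj V c = cube_proj V (set_coord n 0 (z r)) + (1/2 - s - r) *\<^sub>R V n"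
        using z(4)[OF r(1,2)] x(4) r(3) by (simp add: cube_proj_set_coord algebra_simps)
      then have "cube_proj (contraction V n) c = cube_proj (contraction V n) (set_coord n 0 (z r))"
        by (auto simp: contraction_eq_iff)
      ultimately show "cube_proj (contraction V n) c \<in> cube_proj (contraction V n) ` contract_section n Q"
        by blast
    qed
  qed
qed

section \<open>Counting by deletion and contraction\<close>

text \<open>The lower ends of edges in direction \<open>n\<close>: the counterpart of
  \<open>contract_section\<close> for labels.\<close>

definition link_sets :: "'n \<Rightarrow> 'n set set \<Rightarrow> 'n set set" where
  "link_sets n S = {I \<in> S. n \<notin> I \<and> insert n I \<in> S}"

text \<open>By \<open>section_edge\<close>, two vertices of \<open>Q\<close> that differ only in
  \<open>n\<close> bring the whole edge between them into \<open>Q\<close>.\<close>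

lemma vertex_labels_contraction:
  assumes sec: "cubical_section E V Q"
  shows "vertex_labels (contract_section n Q) = link_sets n (vertex_labels Q)"
proof (intro equalityI subsetI)
  fix I assume "I \<in> vertex_labels (contract_section n Q)"
  then have I: "cube_vertex I \<in> contract_section n Q" by (simp add: vertex_labels_def)
  then have nI: "n \<notin> I" by (auto simp: contract_section_def)
  have "set_coord n 0 (cube_vertex I) \<in> Q" "set_coord n 1 (cube_vertex I) \<in> Q"
    using I by (auto simp: contract_section_def)
  moreover have "set_coord n 0 (cube_vertex I) = cube_vertex I"
    "set_coord n 1 (cube_vertex I) = cube_vertex (insert n I)"
    using nI by (auto simp: vec_eq_iff)
  ultimately show "I \<in> link_sets n (vertex_labels Q)" using nI by (simp add: link_sets_def vertex_labels_def)
next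
  fix I assume "I \<in> link_sets n (vertex_labels Q)"
  then have I: "cube_vertex I \<in> Q" "cube_vertex (insert n I) \<in> Q" "n \<notin> I"
    by (auto simp: link_sets_def vertex_labels_def)
  have eq: "cube_vertex (insert n I) = set_coord n 1 (cube_vertex I)" by (simp add: vec_eq_iff)
  show "I \<in> vertex_labels (contract_section n Q)"
    using section_edge[OF sec I(1,2), of n] I(3)
    by (simp add: vertex_labels_def contract_section_def eq cube_proj_set_coord)
qed

lemma card_split_mem:
  fixes S :: "'n::finite set set"
  shows "card S = card {I \<in> S. n \<in> I} + card {I \<in> S. n \<notin> I}"
proof -
  have "S = {I \<in> S. n \<in> I} \<union> {I \<in> S. n \<notin> I}" by blast
  then have "card S = card ({I \<in> S. n \<in> I} \<union> {I \<in> S. n \<notin> I})" by simp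
  also have "\<dots> = card {I \<in> S. n \<in> I} + card {I \<in> S. n \<notin> I}"
    by (rule card_Un_disjoint) auto
  finally show ?thesis .
qed

text \<open>Deletion merges \<open>I\<close> with \<open>insert n I\<close> and nothing else, so the
  link counts exactly what the image loses.\<close>

lemma card_deletion_link:
  fixes S :: "'n::finite set set"
  shows "card S = card ((\<lambda>I. I - {n}) ` S) + card (link_sets n S)"
proof -
  let ?A = "{I \<in> S. n \<in> I}" and ?B = "{I \<in> S. n \<notin> I}"
  have "(\<lambda>I. I - {n}) ` ?B = ?B" by force
  moreover have "S = ?A \<union> ?B" by blast
  ultimately have img: "(\<lambda>I. I - {n}) ` S = (\<lambda>I. I - {n}) ` ?A \<union> ?B"
    by (metis (no_types, lifting) image_Un)
  have int: "(\<lambda>I. I - {n}) ` ?A \<inter> ?B = link_sets n S"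
  proof (intro equalityI subsetI)
    fix I assume I: "I \<in> (\<lambda>I. I - {n}) ` ?A \<inter> ?B"
    then obtain J where "J \<in> S" "n \<in> J" "I = J - {n}" by blast
    with I show "I \<in> link_sets n S" by (simp add: link_sets_def insert_absorb)
  next
    fix I assume I: "I \<in> link_sets n S"
    then have "I = insert n I - {n}" "insert n I \<in> ?A" by (auto simp: link_sets_def)
    then have "I \<in> (\<lambda>I. I - {n}) ` ?A" by (rule image_eqI)
    with I show "I \<in> (\<lambda>I. I - {n}) ` ?A \<inter> ?B" by (simp add: link_sets_def)
  qed
  have "inj_on (\<lambda>I. I - {n}) ?A" by (rule inj_onI) auto
  then have "card ((\<lambda>I. I - {n}) ` ?A) = card ?A" by (rule card_image)
  then show ?thesis
    using card_Un_Int[of "(\<lambda>I. I - {n}) ` ?A" ?B] card_split_mem[of S n] unfolding img int by simp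
qed

lemma ind_sets_deletion:
  assumes "n \<in> E"
  shows "{I \<in> ind_sets E V. n \<notin> I} = ind_sets (E - {n}) V"
  using assms by (auto simp: ind_sets_def)

text \<open>A relation among contracted vectors is a combination of the original ones equal to
  \<open>s *\<^sub>R V n\<close>; the coefficient \<open>- s\<close> at \<open>n\<close> completes
  it to a relation of \<open>V\<close>.\<close>

lemma insert_in_ind_sets_iff:
  assumes "n \<in> E" "V n \<noteq> 0" "n \<notin> I"
  shows "insert n I \<in> ind_sets E V \<longleftrightarrow> I \<in> ind_sets (E - {n}) (contraction V n)"
proof
  assume I: "insert n I \<in> ind_sets E V"
  show "I \<in> ind_sets (E - {n}) (contraction V n)"
    unfolding ind_sets_def mem_Collect_eq
  proof (intro conjI allI impI)
    show "I \<subseteq> E - {n}" using I assms by (auto simp: ind_sets_def)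
    fix x assume x: "\<forall>i. i \<notin> I \<longrightarrow> x $ i = 0" "cube_proj (contraction V n) x = 0"
    then obtain s where s: "cube_proj V x = s *\<^sub>R V n" by (auto simp: contraction_eq_0_iff)
    have "set_coord n (- s) x = 0"
      using I x(1) assms(3) s unfolding ind_sets_def by (auto simp: cube_proj_set_coord)
    then have "\<forall>i. (if i = n then - s else x $ i) = 0" by (simp add: vec_eq_iff)
    moreover have "x $ n = 0" using x assms by simp
    ultimately show "x = 0" by (metis vec_eq_iff zero_index)
  qed
next
  assume I: "I \<in> ind_sets (E - {n}) (contraction V n)"
  show "insert n I \<in> ind_sets E V"
    unfolding ind_sets_def mem_Collect_eq
  proof (intro conjI allI impI)
    show "insert n I \<subseteq> E" using I assms by (auto simp: ind_sets_def)
    fix x assume x: "\<forall>i. i \<notin> insert n I \<longrightarrow> x $ i = 0" "cube_proj V x = 0"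
    have "cube_proj V (set_coord n 0 x) = (- (x $ n)) *\<^sub>R V n"
      using x by (simp add: cube_proj_set_coord)
    then have "cube_proj (contraction V n) (set_coord n 0 x) = 0" unfolding contraction_eq_0_iff by blast
    then have *: "set_coord n 0 x = 0" using I x by (auto simp: ind_sets_def)
    then have "cube_proj V x = x $ n *\<^sub>R V n" using cube_proj_set_coord[of V n 0 x] by (simp add: algebra_simps)
    with x assms have "x $ n = 0" by simp
    with * show "x = 0" by simp
  qed
qed

lemma card_ind_sets:
  assumes "n \<in> E" "V n \<noteq> 0"
  shows "card (ind_sets E V) = card (ind_sets (E - {n}) V) + card (ind_sets (E - {n}) (contraction V n))"
proof -
  let ?A = "{I \<in> ind_sets E V. n \<notin> I}" and ?B = "{I \<in> ind_sets E V. n \<in> I}"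
  let ?C = "ind_sets (E - {n}) (contraction V n)"
  have "n \<notin> I" if "I \<in> ?C" for I using that by (auto simp: ind_sets_def)
  have "?B = insert n ` ?C"
  proof (intro equalityI subsetI)
    fix I assume I: "I \<in> ?B"
    then have eq: "I = insert n (I - {n})" by blast
    then have "I - {n} \<in> ?C"
      using I insert_in_ind_sets_iff[of n E V "I - {n}", OF assms] by simp
    with eq show "I \<in> insert n ` ?C" by (rule image_eqI)
  next
    fix I assume "I \<in> insert n ` ?C"
    then obtain J where "J \<in> ?C" "I = insert n J" by blast
    then show "I \<in> ?B"
      using insert_in_ind_sets_iff[of n E V J, OF assms] \<open>\<And>I. I \<in> ?C \<Longrightarrow> n \<notin> I\<close> by simp
  qed
  moreover have "inj_on (insert n) ?C"
    using \<open>\<And>I. I \<in> ?C \<Longrightarrow> n \<notin> I\<close> by (intro inj_onI) (metis Diff_insert_absorb)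
  ultimately have "card ?B = card ?C" by (simp add: card_image)
  then show ?thesis
    using ind_sets_deletion[OF assms(1), of V] card_split_mem[of "ind_sets E V" n] by simp
qed

lemma ind_sets_loop:
  fixes V :: "'n::finite \<Rightarrow> 'a::euclidean_space"
  assumes "n \<in> E" "V n = 0"
  shows "ind_sets E V = ind_sets (E - {n}) V"
proof -
  have "n \<notin> I" if I: "I \<in> ind_sets E V" for I
  proof
    assume "n \<in> I"
    then have "\<forall>i. i \<notin> I \<longrightarrow> axis n (1::real) $ i = 0" by (auto simp: axis_def)
    moreover have "cube_proj V (axis n 1) = 0" by (simp add: assms(2))
    ultimately have "axis n (1::real) = 0"
      using I unfolding ind_sets_def mem_Collect_eq by blast
    then show False by (simp add: axis_eq_0_iff)
  qed
  then show ?thesis using ind_sets_deletion[OF assms(1), of V] by blast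
qed

lemma ind_sets_empty: "ind_sets {} V = {{}}"
  by (auto simp: ind_sets_def vec_eq_iff)

lemma card_vertex_labels:
  fixes V :: "'n::finite \<Rightarrow> 'a::euclidean_space"
  assumes "cubical_section E V Q"
  shows "card (vertex_labels Q) = card (ind_sets E V)"
  using assms
proof (induction "card E" arbitrary: E V Q)
  case 0
  then have E: "E = {}" by simp
  then have c: "subcube E = {0 :: real^'n}" by (auto simp: subcube_def vec_eq_iff)
  with cubical_sectionD(3,4)[OF 0(2)] have Q: "Q = {0}" by auto
  have "cube_vertex I = 0 \<longleftrightarrow> I = {}" for I :: "'n set" by (auto simp: vec_eq_iff)
  then show ?case unfolding E ind_sets_empty Q vertex_labels_def by simp
next
  case (Suc k)
  then obtain n where n: "n \<in> E" by force
  with Suc have k: "k = card (E - {n})" by simp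
  have del: "card ((\<lambda>I. I - {n}) ` vertex_labels Q) = card (ind_sets (E - {n}) V)"
    using Suc(1)[OF k deletion_section[OF Suc(3) n]] vertex_labels_deletion[OF Suc(3)] by simp
  show ?case
  proof (cases "V n = 0")
    case True
    \<comment> \<open>The two ends of an edge in direction \<open>n\<close> would have the same
      image.\<close>
    have "link_sets n (vertex_labels Q) = {}"
    proof -
      have False if "n \<notin> I" "cube_vertex I \<in> Q" "cube_vertex (insert n I) \<in> Q" for I
      proof -
        have eq: "cube_vertex (insert n I) = set_coord n 1 (cube_vertex I)" by (simp add: vec_eq_iff)
        have "cube_vertex I = cube_vertex (insert n I)"
          using that by (intro cubical_sectionD(5)[OF Suc(3)]) (simp_all add: eq cube_proj_set_coord True)
        with that show False by auto
      qed
      then show ?thesis by (auto simp: link_sets_def vertex_labels_def)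
    qed
    then show ?thesis
      using card_deletion_link[of "vertex_labels Q" n] del ind_sets_loop[of n E V, OF n True] by simp
  next
    case False
    have "card (link_sets n (vertex_labels Q)) = card (ind_sets (E - {n}) (contraction V n))"
      using Suc(1)[OF k contraction_section[OF Suc(3) n False]] vertex_labels_contraction[OF Suc(3)] by simp
    then show ?thesis
      using card_deletion_link[of "vertex_labels Q" n] del card_ind_sets[of n E V, OF n False] by simp
  qed
qed

section \<open>Vertex labels of a section\<close>

lemma subset_of_vertex_labels:
  "cubical_section E V Q \<Longrightarrow> I \<in> vertex_labels Q \<Longrightarrow> I \<subseteq> E"
  using cubical_sectionD(4) by (fastforce simp: vertex_labels_def)

text \<open>For a circuit u with support E, each fibre of the projection is a segment parallel to u, and
  the section picks one of its two end points. By connectedness it is always the same end.\<close>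

lemma section_circuit:
  fixes V :: "'n::finite \<Rightarrow> 'a::euclidean_space"
  assumes sec: "cubical_section E V Q" and IJ: "I \<in> vertex_labels Q" "J \<in> vertex_labels Q"
    and u: "cube_proj V u = 0" "u \<noteq> 0" "\<And>i. u $ i > 0 \<Longrightarrow> i \<in> I - J" "\<And>i. u $ i < 0 \<Longrightarrow> i \<in> J - I"
    and supp: "\<And>i. i \<in> E \<Longrightarrow> u $ i \<noteq> 0"
    and ker: "\<And>w. cube_proj V w = 0 \<Longrightarrow> (\<And>i. i \<notin> E \<Longrightarrow> w $ i = 0) \<Longrightarrow> \<exists>t. w = t *\<^sub>R u"
  shows False
proof -
  note secD = cubical_sectionD[OF sec]
  have IE: "I \<subseteq> E" and JE: "J \<subseteq> E" using IJ subset_of_vertex_labels[OF sec] by blast+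
  have u0: "u $ i = 0" if "i \<notin> E" for i
    using u(3,4)[of i] IE JE that by (cases "u $ i" "0::real" rule: linorder_cases) auto
  \<comment> \<open>Within the cube, \<open>up\<close> holds the points that can move a little along
    \<open>u\<close>, and \<open>dn\<close> those that can move along \<open>-u\<close>. Hence
    \<open>W\<close> omits just the upper ends of the fibres and stays convex.\<close>
  define up where "up = {x::real^'n. \<forall>i. (u $ i > 0 \<longrightarrow> x $ i < 1) \<and> (u $ i < 0 \<longrightarrow> x $ i > 0)}"
  define dn where "dn = {x::real^'n. \<forall>i. (u $ i > 0 \<longrightarrow> x $ i > 0) \<and> (u $ i < 0 \<longrightarrow> x $ i < 1)}"
  have "open {x::real^'n. u $ i > 0 \<longrightarrow> x $ i < 1}" "open {x::real^'n. u $ i < 0 \<longrightarrow> x $ i > 0}"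
    "open {x::real^'n. u $ i > 0 \<longrightarrow> x $ i > 0}" "open {x::real^'n. u $ i < 0 \<longrightarrow> x $ i < 1}" for i
    by (cases "u $ i" "0::real" rule: linorder_cases;
        simp add: open_Collect_less continuous_on_component)+
  then have "open up" "open dn"
    unfolding up_def dn_def Collect_all_eq Collect_conj_eq
    by (intro open_INT open_Int finite ballI; simp)+
  define W where "W = subcube E \<inter> up"
  have "convex W"
  proof (unfold W_def, rule convex_Int [OF convex_subcube])
    have lin: "linear (\<lambda>x::real^'n. x $ i)" for i by (rule linearI) simp_all
    have "convex {x::real^'n. x $ i < 1}" "convex {x::real^'n. x $ i > 0}" for i
      using convex_linear_vimage[OF lin, of "{..<1}" i] convex_linear_vimage[OF lin, of "{0<..}" i]
      by (simp_all add: vimage_def)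
    then have "convex {x::real^'n. u $ i > 0 \<longrightarrow> x $ i < 1}" "convex {x::real^'n. u $ i < 0 \<longrightarrow> x $ i > 0}" for i
      by (cases "u $ i" "0::real" rule: linorder_cases; simp)+
    then show "convex up"
      unfolding up_def Collect_all_eq Collect_conj_eq
      by (intro convex_INT convex_Int; simp)
  qed
  then have conn: "connected (cube_proj V ` W)"
    by (intro connected_continuous_image continuous_on_cube_proj convex_connected)
  obtain g where g: "\<And>x. x \<in> Q \<Longrightarrow> g (cube_proj V x) = x"
    "\<And>x. x \<in> subcube E \<Longrightarrow> g (cube_proj V x) \<in> Q"
    "\<And>x. x \<in> subcube E \<Longrightarrow> cube_proj V (g (cube_proj V x)) = cube_proj V x"
    "continuous_on (cube_proj V ` subcube E) g"
    using cubical_section_lift[OF sec] by blast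
  \<comment> \<open>Small enough for \<open>J + e u\<close> and \<open>I - e u\<close> to remain in
    the cube: \<open>u\<close> points inwards at \<open>J\<close> and \<open>-u\<close> at
    \<open>I\<close>.\<close>
  define e where "e = 1 / norm u"
  have e: "0 < e" "\<And>i. \<bar>e * u $ i\<bar> \<le> 1"
    using u(2) component_le_norm_cart[of u] by (simp_all add: e_def divide_le_eq)
  have conn_g: "connected (g ` cube_proj V ` W)"
    by (rule connected_continuous_image [OF continuous_on_subset [OF g(4)] conn]) (auto simp: W_def)
  moreover have "g ` cube_proj V ` W \<subseteq> up \<union> dn"
  proof (clarify)
    fix x assume x: "x \<in> W" "g (cube_proj V x) \<notin> dn"
    let ?z = "g (cube_proj V x)"
    have xE: "x \<in> subcube E" "x \<in> up" using x by (auto simp: W_def)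
    have zE: "?z \<in> subcube E" using g(2)[OF xE(1)] secD(4) by blast
    \<comment> \<open>The lift lies on the fibre of \<open>x\<close>. Displaced by
      \<open>t > 0\<close> it can move back, so it is in \<open>dn\<close>; for
      \<open>t \<le> 0\<close> it keeps the room upwards that \<open>x\<close> has.\<close>
    have "cube_proj V (?z - x) = 0" using g(3)[OF xE(1)] by simp
    then obtain t where t: "?z - x = t *\<^sub>R u"
      using ker[of "?z - x"] xE zE by (auto simp: subcube_def)
    then have z: "?z $ i = x $ i + t * u $ i" for i by (simp add: algebra_simps vec_eq_iff)
    have "t \<le> 0"
    proof (rule ccontr)
      assume "\<not> t \<le> 0"
      then have "0 < t * u $ i" if "u $ i > 0" for i using that by simp
      moreover have "t * u $ i < 0" if "u $ i < 0" for i using that \<open>\<not> t \<le> 0\<close> by (simp add: mult_pos_neg)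
      ultimately have "?z \<in> dn"
        using xE(1) unfolding dn_def z subcube_def by (smt (verit) mem_Collect_eq z)
      with x show False by simp
    qed
    then have "t * u $ i \<le> 0" if "u $ i > 0" for i using that by (simp add: mult_le_0_iff)
    moreover have "0 \<le> t * u $ i" if "u $ i < 0" for i using that \<open>t \<le> 0\<close> by (simp add: zero_le_mult_iff)
    ultimately show "?z \<in> up"
      using xE(2) unfolding up_def mem_Collect_eq z by (smt (verit))
  qed
  \<comment> \<open>A lift in both sets has all coordinates of \<open>E\<close> strictly between 0
    and 1, as \<open>u\<close> vanishes nowhere on \<open>E\<close>. Its cell is then the whole
    \<open>subcube E\<close>, where the projection is not injective.\<close>
  moreover have "up \<inter> dn \<inter> g ` cube_proj V ` W = {}"
  proof (rule ccontr)
    assume "up \<inter> dn \<inter> g ` cube_proj V ` W \<noteq> {}"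
    then obtain x where "x \<in> W" "g (cube_proj V x) \<in> up \<inter> dn" by blast
    moreover define z where "z = g (cube_proj V x)"
    ultimately have z: "z \<in> Q" "z \<in> up" "z \<in> dn" using g(2) by (auto simp: W_def)
    have "0 < z $ i \<and> z $ i < 1" if "i \<in> E" for i
      using supp[OF that] z(2,3) secD(4) z(1)
      by (cases "u $ i" "0::real" rule: linorder_cases) (auto simp: up_def dn_def)
    moreover have "z $ i = 0" if "i \<notin> E" for i using that z(1) secD(4) by (auto simp: subcube_def)
    ultimately have z01: "if i \<in> E then z $ i \<noteq> 0 \<and> z $ i \<noteq> 1 else z $ i = 0" for i
      by (metis less_irrefl)
    have "carried_by y z" if y: "y \<in> subcube E" for y
      unfolding carried_by_def
    proof
      fix i
      have "i \<notin> E \<Longrightarrow> y $ i = 0" using y by (simp add: subcube_def)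
      with z01[of i] show "(z $ i = 0 \<longrightarrow> y $ i = 0) \<and> (z $ i = 1 \<longrightarrow> y $ i = 1)"
        by (simp split: if_splits)
    qed
    then have cz: "y \<in> Q" if "y \<in> subcube E" for y
      using secD(6)[OF z(1) that] that by blast
    have "cube_vertex J \<in> Q" using IJ by (simp add: vertex_labels_def)
    have "cube_vertex J + e *\<^sub>R u \<in> subcube E"
    proof -
      have "0 \<le> cube_vertex J $ i + e * u $ i \<and> cube_vertex J $ i + e * u $ i \<le> 1" for i
        using u(3,4)[of i] e(2)[of i] e(1)
        by (cases "u $ i" "0::real" rule: linorder_cases) (auto simp: abs_le_iff mult_pos_neg less_imp_le)
      then show ?thesis using JE u0 by (auto simp: subcube_def)
    qed
    then have "cube_vertex J + e *\<^sub>R u = cube_vertex J"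
      by (intro secD(5)[OF cz \<open>cube_vertex J \<in> Q\<close>]) (simp_all add: u(1))
    with e u(2) show False by simp
  qed
  ultimately have "up \<inter> g ` cube_proj V ` W = {} \<or> dn \<inter> g ` cube_proj V ` W = {}"
    using \<open>open up\<close> \<open>open dn\<close> connectedD by blast
  \<comment> \<open>\<open>J\<close> is the lower end of its fibre, \<open>I\<close> the upper end
    of its own. \<open>I\<close> is not in \<open>W\<close>, but the point \<open>I - e u\<close> of
    the same fibre is.\<close>
  moreover have "cube_vertex J \<in> up \<inter> g ` cube_proj V ` W"
  proof -
    have "cube_vertex J \<in> up" using u(3,4) by (auto simp: up_def)
    moreover from this have "cube_vertex J \<in> W" using JE by (simp add: W_def)
    then have "g (cube_proj V (cube_vertex J)) \<in> g ` cube_proj V ` W" by blast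
    ultimately show ?thesis using g(1)[of "cube_vertex J"] IJ by (simp add: vertex_labels_def)
  qed
  moreover have "cube_vertex I \<in> dn \<inter> g ` cube_proj V ` W"
  proof -
    have "cube_vertex I \<in> dn" using u(3,4) by (auto simp: dn_def)
    moreover have "cube_vertex I - e *\<^sub>R u \<in> W"
    proof -
      have "0 \<le> cube_vertex I $ i - e * u $ i \<and> cube_vertex I $ i - e * u $ i \<le> 1" for i
        using u(3,4)[of i] e(2)[of i] e(1)
        by (cases "u $ i" "0::real" rule: linorder_cases) (auto simp: abs_le_iff mult_pos_neg less_imp_le)
      then have "cube_vertex I - e *\<^sub>R u \<in> subcube E" using IE u0 by (auto simp: subcube_def)
      moreover have "cube_vertex I - e *\<^sub>R u \<in> up"
        using u(3,4) e(1) by (auto simp: up_def mult_pos_neg)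
      ultimately show ?thesis by (simp add: W_def)
    qed
    then have "g (cube_proj V (cube_vertex I - e *\<^sub>R u)) \<in> g ` cube_proj V ` W" by blast
    ultimately show ?thesis using g(1)[of "cube_vertex I"] IJ u(1) by (simp add: vertex_labels_def)
  qed
  ultimately show False by blast
qed

text \<open>A violating vector that vanishes somewhere on \<open>E\<close> survives a deletion, so
  on a smallest \<open>E\<close> it has full support. Every kernel vector on \<open>E\<close> is
  then a multiple of it, which reduces the claim to a circuit.\<close>

lemma vertex_labels_conformal:
  fixes V :: "'n::finite \<Rightarrow> 'a::euclidean_space"
  assumes "cubical_section E V Q" "I \<in> vertex_labels Q" "J \<in> vertex_labels Q"
    "cube_proj V u = 0" "\<forall>i. u $ i > 0 \<longrightarrow> i \<in> I - J" "\<forall>i. u $ i < 0 \<longrightarrow> i \<in> J - I"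
  shows "u = 0"
  using assms
proof (induction "card E" arbitrary: E Q I J u rule: less_induct)
  case less
  have IE: "I \<subseteq> E" and JE: "J \<subseteq> E" using less subset_of_vertex_labels by blast+
  have delete: "w = 0"
    if w: "n \<in> E" "w $ n = 0" "cube_proj V w = 0" "\<forall>i. w $ i > 0 \<longrightarrow> i \<in> I - J" "\<forall>i. w $ i < 0 \<longrightarrow> i \<in> J - I" for n w
  proof (rule less.hyps [OF _ deletion_section[OF less.prems(1) w(1)]])
    show "card (E - {n}) < card E" using w(1) by (intro card_Diff1_less) auto
    show "I - {n} \<in> vertex_labels (set_coord n 0 ` Q)" "J - {n} \<in> vertex_labels (set_coord n 0 ` Q)"
      using less.prems(2,3) vertex_labels_deletion[OF less.prems(1)] by auto
  qed (use w in auto)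
  show "u = 0"
  proof (rule ccontr)
    assume "u \<noteq> 0"
    then have supp: "u $ i \<noteq> 0" if "i \<in> E" for i using delete[of i u] that less.prems by blast
    have "E \<noteq> {}"
    proof
      assume "E = {}"
      then have "u = 0" using less.prems(5,6) IE JE
        by (metis Diff_iff empty_iff linorder_neqE_linordered_idom subset_empty vec_eq_iff zero_index)
      with \<open>u \<noteq> 0\<close> show False ..
    qed
    have "\<exists>t. w = t *\<^sub>R u" if w: "cube_proj V w = 0" "\<And>i. i \<notin> E \<Longrightarrow> w $ i = 0" for w
    proof -
      \<comment> \<open>With the largest ratio, \<open>M *\<^sub>R u - w\<close> has the sign of
        \<open>u\<close> wherever it is nonzero, and it vanishes where the maximum is attained;
        deleting that element shows that it is 0.\<close>
      define M where "M = Max ((\<lambda>i. w $ i / u $ i) ` E)"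
      have M: "w $ i / u $ i \<le> M" if "i \<in> E" for i using that by (simp add: M_def)
      have "M \<in> (\<lambda>i. w $ i / u $ i) ` E" unfolding M_def using \<open>E \<noteq> {}\<close> by (intro Max_in) auto
      then obtain n where n: "n \<in> E" "M = w $ n / u $ n" by blast
      have v: "(M *\<^sub>R u - w) $ i = u $ i * (M - w $ i / u $ i)" if "i \<in> E" for i
        using supp[OF that] by (simp add: field_simps)
      have u0: "u $ i = 0" if "i \<notin> E" for i
        using less.prems(5,6) IE JE that by (metis Diff_iff linorder_neqE_linordered_idom subset_iff)
      have "(M *\<^sub>R u - w) $ i > 0 \<longrightarrow> u $ i > 0" "(M *\<^sub>R u - w) $ i < 0 \<longrightarrow> u $ i < 0" for i
        using v[of i] M[of i] u0[of i] w(2)[of i]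
        by (cases "i \<in> E"; simp add: zero_less_mult_iff mult_less_0_iff)+
      then have "M *\<^sub>R u - w = 0"
        using less.prems(4-6) w(1) n supp[OF n(1)] by (intro delete[OF n(1)]) auto
      then have "w = M *\<^sub>R u" by simp
      then show ?thesis ..
    qed
    then show False
      using section_circuit[OF less.prems(1-4) \<open>u \<noteq> 0\<close> _ _ supp] less.prems(5,6) by blast
  qed
qed

lemma vertex_labels_separated:
  assumes "cubical_section E V Q"
  shows "V_separated_collection V (vertex_labels Q)"
  unfolding V_separated_collection_def V_separated_iff
  using vertex_labels_conformal[OF assms] by blast

text \<open>Every point of the larger zonotope is lifted with the smallest possible coordinate n. Then x n > 0
  happens only where a ray in direction V n leaves the zonotope of E.\<close>

lemma cubical_section_insert:
  fixes V :: "'n::finite \<Rightarrow> 'a::euclidean_space"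
  assumes sec: "cubical_section E V Q" and n: "n \<notin> E"
  shows "\<exists>Q'. cubical_section (insert n E) V Q'"
proof -
  note secD = cubical_sectionD[OF sec]
  \<comment> \<open>The image of \<open>x\<close> is the last point of its ray in the zonotope of
    \<open>E\<close>. If \<open>V n = 0\<close>, no point of \<open>subcube E\<close> qualifies and
    \<open>Q'\<close> stays at height 0.\<close>
  define exit where "exit = (\<lambda>x. \<forall>r>0. cube_proj V x + r *\<^sub>R V n \<notin> cube_proj V ` subcube E)"
  define Q' where "Q' = {x. 0 \<le> x $ n \<and> x $ n \<le> 1 \<and> set_coord n 0 x \<in> Q \<and> (x $ n \<noteq> 0 \<longrightarrow> exit (set_coord n 0 x))}"
  have En: "insert n E - {n} = E" using n by auto
  have "cubical_section (insert n E) V Q'"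
    unfolding cubical_section_def
  proof (intro conjI)
    have sub: "Q' \<subseteq> subcube (insert n E)"
    proof
      fix x assume x: "x \<in> Q'"
      then have "set_coord n (x $ n) (set_coord n 0 x) \<in> subcube (insert n E)"
        using set_coord_in_subcube_insert[of "set_coord n 0 x" "insert n E" n "x $ n"] secD(4)
        by (auto simp: Q'_def En)
      then show "x \<in> subcube (insert n E)" by simp
    qed
    show "facial (insert n E) Q'"
      unfolding facial_def
    proof (intro conjI sub ballI impI)
      fix x y assume x: "x \<in> Q'" and y: "y \<in> subcube (insert n E)" "carried_by y x"
      let ?x = "set_coord n 0 x" and ?y = "set_coord n 0 y"
      have Q: "?x \<in> Q" using x by (simp add: Q'_def)
      have yE: "?y \<in> subcube E" using set_coord_0_in_subcube[OF y(1), of n] by (simp add: En)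
      have c: "carried_by ?y ?x" using y(2) by (simp add: carried_by_def)
      \<comment> \<open>If the ray could be continued from \<open>?y\<close>,
        \<open>subcube_step\<close> would continue it from \<open>?x\<close> as well.\<close>
      have "exit ?y" if "y $ n \<noteq> 0"
        unfolding exit_def
      proof (intro allI impI notI)
        fix r :: real assume r: "r > 0" "cube_proj V ?y + r *\<^sub>R V n \<in> cube_proj V ` subcube E"
        then obtain z where z: "z \<in> subcube E" "cube_proj V z = cube_proj V ?y + r *\<^sub>R V n" by force
        obtain e where e: "e > 0" "?x + e *\<^sub>R (z - ?y) \<in> subcube E"
          using subcube_step[OF _ yE z(1) c] Q secD(4) by blast
        have "cube_proj V (?x + e *\<^sub>R (z - ?y)) = cube_proj V ?x + (e * r) *\<^sub>R V n"
          using z(2) by simp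
        then have "cube_proj V ?x + (e * r) *\<^sub>R V n \<in> cube_proj V ` subcube E" using e(2) by (metis imageI)
        moreover have "exit ?x" using x that y(2) by (auto simp: Q'_def carried_by_def)
        moreover have "e * r > 0" using e r by simp
        ultimately show False by (auto simp: exit_def)
      qed
      then show "y \<in> Q'"
        using y(1) secD(6)[OF Q yE c] by (simp add: Q'_def subcube_def)
    qed
    have le: "x = y" if xy: "x \<in> Q'" "y \<in> Q'" "cube_proj V x = cube_proj V y" "x $ n \<le> y $ n" for x y
    proof -
      let ?x = "set_coord n 0 x" and ?y = "set_coord n 0 y"
      have Q: "?x \<in> Q" "?y \<in> Q" using xy by (auto simp: Q'_def)
      have p: "cube_proj V ?x = cube_proj V ?y + (y $ n - x $ n) *\<^sub>R V n"
        using xy(3) by (simp add: cube_proj_set_coord algebra_simps)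
      have "x $ n = y $ n"
      proof (rule ccontr)
        assume "x $ n \<noteq> y $ n"
        then have "exit ?y" "y $ n - x $ n > 0" using xy by (auto simp: Q'_def)
        then show False using Q(1) secD(4) p unfolding exit_def by (metis imageI subsetD)
      qed
      moreover from this have "?x = ?y" using p by (intro secD(5)[OF Q]) simp
      ultimately show "x = y" by (metis set_coord_set_coord set_coord_triv)
    qed
    show "inj_on (cube_proj V) Q'"
    proof (rule inj_onI)
      fix x y assume "x \<in> Q'" "y \<in> Q'" "cube_proj V x = cube_proj V y"
      then show "x = y" using le[of x y] le[of y x] by (cases "x $ n \<le> y $ n") auto
    qed
    show "cube_proj V ` Q' = cube_proj V ` subcube (insert n E)"
    proof
      show "cube_proj V ` Q' \<subseteq> cube_proj V ` subcube (insert n E)" using sub by (rule image_mono)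
      show "cube_proj V ` subcube (insert n E) \<subseteq> cube_proj V ` Q'"
      proof (clarify)
        fix c assume c: "c \<in> subcube (insert n E)"
        define K where "K = subcube (insert n E) \<inter> {x. cube_proj V x = cube_proj V c}"
        have "closed {x. cube_proj V x = cube_proj V c}"
          by (intro closed_Collect_eq continuous_on_cube_proj continuous_on_const)
        then have "compact K" unfolding K_def by (rule compact_Int_closed [OF compact_subcube])
        moreover have "c \<in> K" using c by (simp add: K_def)
        moreover have "continuous_on K (\<lambda>x. x $ n)" by (intro continuous_intros)
        ultimately obtain y where y: "y \<in> K" "\<And>z. z \<in> K \<Longrightarrow> y $ n \<le> z $ n"
          using continuous_attains_inf[of K "\<lambda>x. x $ n"] by blast
        have yE: "set_coord n 0 y \<in> subcube E"
          using set_coord_0_in_subcube[of y "insert n E" n] y(1) by (simp add: K_def En)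
        then obtain q where q: "q \<in> Q" "cube_proj V q = cube_proj V (set_coord n 0 y)"
          using secD(3) by (metis imageE imageI)
        have qE: "q \<in> subcube E" using q secD(4) by blast
        then have qn: "q $ n = 0" using n by (simp add: subcube_def)
        have y01: "0 \<le> y $ n" "y $ n \<le> 1" using y(1) by (simp_all add: K_def subcube_def)
        have py: "cube_proj V q = cube_proj V c - y $ n *\<^sub>R V n"
          using q(2) y(1) by (simp add: K_def cube_proj_set_coord)
        have "exit q" if "y $ n \<noteq> 0"
          unfolding exit_def
        proof (intro allI impI notI)
          fix r :: real assume r: "r > 0" "cube_proj V q + r *\<^sub>R V n \<in> cube_proj V ` subcube E"
          then obtain z where z: "z \<in> subcube E" "cube_proj V z = cube_proj V q + r *\<^sub>R V n" by force
          \<comment> \<open>Moving from \<open>q\<close> towards \<open>z\<close> gains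
            \<open>t * r\<close> in direction \<open>V n\<close>, which is taken off coordinate
            \<open>n\<close>. The cap \<open>y $ n / r\<close> keeps that coordinate nonnegative and
            the cap 1 keeps \<open>w\<close> on the segment; the result undercuts the minimum
            \<open>y $ n\<close>.\<close>
          define t where "t = min 1 (y $ n / r)"
          have t: "0 < t" "t \<le> 1" "t * r \<le> y $ n"
            using r y01 that by (auto simp: t_def min_def field_simps)
          define w where "w = q + t *\<^sub>R (z - q)"
          have "(1 - t) *\<^sub>R q + t *\<^sub>R z \<in> subcube E"
            using convexD_alt[OF convex_subcube qE z(1)] t by simp
          then have wE: "w \<in> subcube E" by (simp add: w_def algebra_simps)
          then have wn: "w $ n = 0" using n by (simp add: subcube_def)
          have pw: "cube_proj V w = cube_proj V q + (t * r) *\<^sub>R V n" by (simp add: w_def z(2))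
          have "set_coord n (y $ n - t * r) w \<in> K"
            unfolding K_def
          proof (intro IntI CollectI)
            show "set_coord n (y $ n - t * r) w \<in> subcube (insert n E)"
              using wE t y01 r by (intro set_coord_in_subcube_insert) (auto simp: En intro: order_trans[of _ "y $ n"])
            show "cube_proj V (set_coord n (y $ n - t * r) w) = cube_proj V c"
              by (simp add: cube_proj_set_coord wn pw py algebra_simps)
          qed
          from y(2)[OF this] have "t * r \<le> 0" by simp
          with t r show False by (simp add: mult_le_0_iff)
        qed
        then have "set_coord n (y $ n) q \<in> Q'" using q(1) qn y01 by (simp add: Q'_def)
        moreover have "cube_proj V (set_coord n (y $ n) q) = cube_proj V c"
          by (simp add: cube_proj_set_coord qn py)
        ultimately show "cube_proj V c \<in> cube_proj V ` Q'" by (metis imageI)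
      qed
    qed
  qed
  then show ?thesis ..
qed

text \<open>The labels of such a section show that the bound on separated collections is
  attained.\<close>

lemma cubical_section_exists:
  fixes V :: "'n::finite \<Rightarrow> 'a::euclidean_space"
  shows "\<exists>Q. cubical_section E V Q"
proof (induction E rule: finite_induct [OF finite])
  case 1
  have "subcube {} = {0 :: real^'n}" by (auto simp: subcube_def vec_eq_iff)
  then have "cubical_section {} V {0}" by (simp add: cubical_section_def facial_def)
  then show ?case ..
next
  case (2 n E)
  then show ?case using cubical_section_insert by blast
qed

section \<open>The section spanned by a separated collection\<close>

lemma V_separatedD:
  fixes V :: "'n::finite \<Rightarrow> 'a::euclidean_space"
  assumes "V_separated V I J" "cube_proj V u = 0"
    "\<And>i. u $ i > 0 \<Longrightarrow> i \<in> I - J" "\<And>i. u $ i < 0 \<Longrightarrow> i \<in> J - I"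
  shows "u = 0"
  using assms unfolding V_separated_iff by blast

section \<open>Upper bound on separated collections\<close>

lemma V_separated_collection_deletion:
  assumes "V_separated_collection V S"
  shows "V_separated_collection V ((\<lambda>I. I - {n}) ` S)"
  unfolding V_separated_collection_def
proof (intro ballI)
  fix I J assume "I \<in> (\<lambda>I. I - {n}) ` S" "J \<in> (\<lambda>I. I - {n}) ` S"
  then obtain I' J' where *: "I = I' - {n}" "J = J' - {n}" "I' \<in> S" "J' \<in> S" by blast
  then have "V_separated V I' J'" using assms by (auto simp: V_separated_collection_def)
  with * show "V_separated V I J" unfolding V_separated_def by blast
qed

text \<open>A violating relation for the contraction becomes one for \<open>V\<close> with
  coefficient \<open>- s\<close> at \<open>n\<close>. Since the link provides both versions of each
  set, \<open>n\<close> can be put on the side that this sign demands: into \<open>J\<close> for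
  \<open>s \<ge> 0\<close>, into \<open>I\<close> otherwise.\<close>

lemma V_separated_collection_contraction:
  fixes V :: "'n::finite \<Rightarrow> 'a::euclidean_space"
  assumes "V_separated_collection V S"
  shows "V_separated_collection (contraction V n) (link_sets n S)"
  unfolding V_separated_collection_def V_separated_iff
proof (intro ballI allI impI)
  fix I J :: "'n set" and u
  assume I: "I \<in> link_sets n S" and J: "J \<in> link_sets n S"
    and u: "cube_proj (contraction V n) u = 0" "\<forall>i. 0 < u $ i \<longrightarrow> i \<in> I - J" "\<forall>i. u $ i < 0 \<longrightarrow> i \<in> J - I"
  obtain s where s: "cube_proj V u = s *\<^sub>R V n" using u(1) by (auto simp: contraction_eq_0_iff)
  have nIJ: "n \<notin> I" "n \<notin> J" using I J by (auto simp: link_sets_def)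
  then have un: "u $ n = 0" using u(2,3) by (metis Diff_iff linorder_neqE_linordered_idom)
  define w where "w = set_coord n (- s) u"
  have w: "cube_proj V w = 0" by (simp add: w_def cube_proj_set_coord un s)
  have "w = 0"
  proof (cases "s \<ge> 0")
    case True
    have "V_separated V I (insert n J)"
      using I J assms by (auto simp: link_sets_def V_separated_collection_def)
    then show ?thesis
      by (rule V_separatedD[OF _ w]) (use True u nIJ in \<open>auto simp: w_def split: if_splits\<close>)
  next
    case False
    have "V_separated V (insert n I) J"
      using I J assms by (auto simp: link_sets_def V_separated_collection_def)
    then show ?thesis
      by (rule V_separatedD[OF _ w]) (use False u nIJ in \<open>auto simp: w_def split: if_splits\<close>)
  qed
  have "u = set_coord n 0 w" by (simp add: w_def un)
  with \<open>w = 0\<close> show "u = 0" by (simp add: vec_eq_iff)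
qed

text \<open>For a zero vector the unit vector at \<open>n\<close> is itself in the kernel, and it
  obstructs separating a set with \<open>n\<close> from one without.\<close>

lemma separated_agree_on_loop:
  fixes V :: "'n::finite \<Rightarrow> 'a::euclidean_space"
  assumes S: "V_separated_collection V S" and n: "V n = 0" and IJ: "I \<in> S" "J \<in> S" "n \<in> I"
  shows "n \<in> J"
proof (rule ccontr)
  assume "n \<notin> J"
  have "V_separated V I J" using IJ S by (simp add: V_separated_collection_def)
  then have "axis n (1::real) = 0"
  proof (rule V_separatedD)
    show "cube_proj V (axis n 1) = 0" by (simp add: n)
  qed (use IJ \<open>n \<notin> J\<close> in \<open>auto simp: axis_def split: if_splits\<close>)
  then show False by (simp add: axis_eq_0_iff)
qed

lemma card_V_separated_le:
  fixes V :: "'n::finite \<Rightarrow> 'a::euclidean_space"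
  assumes "V_separated_collection V S" "S \<subseteq> Pow E"
  shows "card S \<le> card (ind_sets E V)"
  using assms
proof (induction "card E" arbitrary: E V S)
  case 0
  then have "S \<subseteq> {{}}" by simp
  then show ?case using 0 card_mono[of "{{}}" S] by (simp add: ind_sets_empty)
next
  case (Suc k)
  then obtain n where n: "n \<in> E" by force
  with Suc have k: "k = card (E - {n})" by simp
  have del: "card ((\<lambda>I. I - {n}) ` S) \<le> card (ind_sets (E - {n}) V)"
    using Suc.prems by (intro Suc(1)[OF k] V_separated_collection_deletion) auto
  \<comment> \<open>The truncated difference treats zero and nonzero \<open>V n\<close> uniformly;
    monotonicity of \<open>ind_sets\<close> in \<open>E\<close> allows it to be added back.\<close>
  have "card (link_sets n S) \<le> card (ind_sets E V) - card (ind_sets (E - {n}) V)"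
  proof (cases "V n = 0")
    case True
    have "link_sets n S = {}"
      using separated_agree_on_loop[OF Suc.prems(1) True] by (auto simp: link_sets_def)
    then show ?thesis by simp
  next
    case False
    have "card (link_sets n S) \<le> card (ind_sets (E - {n}) (contraction V n))"
      using Suc.prems by (intro Suc(1)[OF k] V_separated_collection_contraction) (auto simp: link_sets_def)
    then show ?thesis using card_ind_sets[of n E V, OF n False] by simp
  qed
  moreover have "card (ind_sets (E - {n}) V) \<le> card (ind_sets E V)"
    by (rule card_mono) (auto simp: ind_sets_def)
  ultimately show ?case using card_deletion_link[of S n] del by linarith
qed

section \<open>Cells with all vertices in a collection\<close>

text \<open>For \<open>x\<close> in the cube these are the vertices of the smallest face containing
  it, an interval in the subset lattice.\<close>

definition cell_labels :: "real^'n::finite \<Rightarrow> 'n set set" where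
  "cell_labels x = {X. {i. x $ i = 1} \<subseteq> X \<and> X \<subseteq> {i. x $ i \<noteq> 0}}"

definition spanned_cells :: "'n::finite set \<Rightarrow> 'n set set \<Rightarrow> (real^'n) set" where
  "spanned_cells E S = {x \<in> subcube E. cell_labels x \<subseteq> S}"

lemma cell_labels_mono: "carried_by y x \<Longrightarrow> cell_labels y \<subseteq> cell_labels x"
  by (auto simp: cell_labels_def carried_by_def)

lemma cell_labels_cube_vertex [simp]: "cell_labels (cube_vertex I) = {I}"
  by (auto simp: cell_labels_def)

lemma facial_spanned_cells: "facial E (spanned_cells E S)"
  using cell_labels_mono by (fastforce simp: facial_def spanned_cells_def)

lemma carried_by_spanned_cells:
  "carried_by y x \<Longrightarrow> x \<in> spanned_cells E S \<Longrightarrow> y \<in> subcube E \<Longrightarrow> y \<in> spanned_cells E S"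
  using facial_spanned_cells unfolding facial_def by blast

lemma vertex_labels_spanned_cells: "S \<subseteq> Pow E \<Longrightarrow> vertex_labels (spanned_cells E S) = S"
  by (auto simp: vertex_labels_def spanned_cells_def)

text \<open>The vertex of the cell of \<open>x\<close> pushed away from \<open>y\<close> in every
  free coordinate.\<close>

lemma cell_label_away_from:
  assumes "x \<in> subcube E"
  obtains X where "X \<in> cell_labels x" "\<And>i. x $ i < y $ i \<Longrightarrow> i \<notin> X \<or> x $ i = 1" "\<And>i. y $ i < x $ i \<Longrightarrow> i \<in> X \<or> x $ i = 0"
proof
  let ?X = "{i. x $ i = 1 \<or> x $ i \<noteq> 0 \<and> y $ i < x $ i}"
  show "?X \<in> cell_labels x" by (auto simp: cell_labels_def)
qed auto

text \<open>If \<open>x\<close> and \<open>y\<close> have equal images, take the vertex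
  \<open>X\<close> of the cell of \<open>x\<close> pushed away from \<open>y\<close> and the vertex
  \<open>Y\<close> pushed the other way. The kernel vector \<open>x - y\<close> is positive only on
  \<open>X - Y\<close> and negative only on \<open>Y - X\<close>, so separation makes it 0.\<close>

lemma inj_on_spanned_cells:
  fixes V :: "'n::finite \<Rightarrow> 'a::euclidean_space"
  assumes S: "V_separated_collection V S"
  shows "inj_on (cube_proj V) (spanned_cells E S)"
proof (rule inj_onI)
  fix x y assume x: "x \<in> spanned_cells E S" and y: "y \<in> spanned_cells E S"
    and p: "cube_proj V x = cube_proj V y"
  have xy: "x \<in> subcube E" "y \<in> subcube E" using x y by (auto simp: spanned_cells_def)
  have le: "0 \<le> x $ i" "x $ i \<le> 1" "0 \<le> y $ i" "y $ i \<le> 1" for i using xy by (auto simp: subcube_def)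
  obtain X where X: "X \<in> cell_labels x" "\<And>i. x $ i < y $ i \<Longrightarrow> i \<notin> X \<or> x $ i = 1" "\<And>i. y $ i < x $ i \<Longrightarrow> i \<in> X \<or> x $ i = 0"
    using cell_label_away_from[OF xy(1)] by blast
  obtain Y where Y: "Y \<in> cell_labels y" "\<And>i. y $ i < x $ i \<Longrightarrow> i \<notin> Y \<or> y $ i = 1" "\<And>i. x $ i < y $ i \<Longrightarrow> i \<in> Y \<or> y $ i = 0"
    using cell_label_away_from[OF xy(2)] by blast
  have "V_separated V X Y" using S X(1) Y(1) x y by (auto simp: spanned_cells_def V_separated_collection_def)
  then have "x - y = 0"
  proof (rule V_separatedD)
    show "i \<in> X - Y" if "(x - y) $ i > 0" for i
      using that X(3)[of i] Y(2)[of i] le[of i] by auto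
    show "i \<in> Y - X" if "(x - y) $ i < 0" for i
      using that X(2)[of i] Y(3)[of i] le[of i] by auto
  qed (simp add: p)
  then show "x = y" by simp
qed

text \<open>The sign e distinguishes the two sides of the section over the contraction: cells of the deletion
  below it stay in place, cells above it are shifted by V n.\<close>

lemma lifted_cell_labels:
  fixes V :: "'n::finite \<Rightarrow> 'a::euclidean_space"
  assumes S: "V_separated_collection V S" "S \<subseteq> Pow E" and n: "n \<in> E" "V n \<noteq> 0"
    and sec: "cubical_section (E - {n}) (contraction V n) (spanned_cells (E - {n}) (link_sets n S))"
    and x: "x \<in> spanned_cells (E - {n}) ((\<lambda>I. I - {n}) ` S)"
    and x0: "x0 \<in> spanned_cells (E - {n}) (link_sets n S)"
    and p: "cube_proj V x = cube_proj V x0 + t *\<^sub>R V n" and t: "e * t > 0"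
    and X: "X \<in> cell_labels x" and e: "e = 1 \<or> e = (-1::real)"
  shows "(if e = 1 then insert n X else X) \<in> S"
proof -
  let ?F = "E - {n}" and ?W = "contraction V n"
  let ?S' = "(\<lambda>I. I - {n}) ` S"
  let ?Q' = "spanned_cells ?F ?S'" and ?Q'' = "spanned_cells ?F (link_sets n S)"
  have S'': "link_sets n S \<subseteq> ?S'" by (force simp: link_sets_def)
  then have Q'': "?Q'' \<subseteq> ?Q'" by (auto simp: spanned_cells_def)
  have inj: "y = z" if "y \<in> ?Q'" "z \<in> ?Q'" "cube_proj V y = cube_proj V z" for y z
    using inj_on_spanned_cells[OF V_separated_collection_deletion[OF S(1)]] that by (metis inj_onD)
  have X': "X \<in> ?S'" using x X by (auto simp: spanned_cells_def)
  then have nX: "n \<notin> X" "X \<subseteq> ?F" using S(2) by auto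
  \<comment> \<open>At least one lift of \<open>X\<close> is in \<open>S\<close>; the sign has to
    decide which.\<close>
  have X_or: "X \<in> S \<or> insert n X \<in> S"
  proof -
    obtain I where "I \<in> S" "X = I - {n}" using X' by blast
    then show ?thesis by (cases "n \<in> I") (simp_all add: insert_absorb)
  qed
  obtain g where g: "\<And>z. z \<in> subcube ?F \<Longrightarrow> g (cube_proj ?W z) \<in> ?Q''"
    "\<And>z. z \<in> subcube ?F \<Longrightarrow> cube_proj ?W (g (cube_proj ?W z)) = cube_proj ?W z"
    "continuous_on (cube_proj ?W ` subcube ?F) g"
    "\<And>z. z \<in> ?Q'' \<Longrightarrow> g (cube_proj ?W z) = z"
    using cubical_section_lift[OF sec] by metis
  \<comment> \<open>\<open>h z\<close> is the point of the section over the contraction on the line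
    through \<open>z\<close>, and \<open>f z\<close> the signed distance from it in units of
    \<open>V n\<close>.\<close>
  define h where "h = (\<lambda>z. g (cube_proj ?W z))"
  define f where "f = (\<lambda>z. ((cube_proj V z - cube_proj V (h z)) \<bullet> V n) / (V n \<bullet> V n))"
  have fz: "cube_proj V z = cube_proj V (h z) + f z *\<^sub>R V n" if z: "z \<in> subcube ?F" for z
  proof -
    obtain s where "cube_proj V z = cube_proj V (h z) + s *\<^sub>R V n"
      using g(2)[OF z] contraction_eq_iff[of V n z "h z"] by (auto simp: h_def)
    moreover from this have "f z = s" using n(2) by (simp add: f_def)
    ultimately show ?thesis by simp
  qed
  have "continuous_on (subcube ?F) h"
    unfolding h_def by (rule continuous_on_compose2 [OF g(3) continuous_on_cube_proj]) simp
  then have cont: "continuous_on (subcube ?F) f"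
    unfolding f_def using n(2)
    by (intro continuous_intros continuous_on_compose2 [OF continuous_on_cube_proj]) auto
  have xF: "x \<in> subcube ?F" and x0F: "x0 \<in> subcube ?F" using x x0 by (auto simp: spanned_cells_def)
  have "h x = h x0" unfolding h_def by (rule arg_cong[of _ _ g]) (use p contraction_eq_iff in blast)
  also have "\<dots> = x0" using g(4)[OF x0] by (simp add: h_def)
  finally have hx: "h x = x0" .
  have fx: "f x = t" using n(2) by (simp add: f_def hx p)
  define l where "l = (\<lambda>r. (1 - r) *\<^sub>R x + r *\<^sub>R cube_vertex X)"
  have XF: "cube_vertex X \<in> subcube ?F" using nX by simp
  have lF: "l r \<in> subcube ?F" if "0 \<le> r" "r \<le> 1" for r
    unfolding l_def using convexD_alt[OF convex_subcube xF XF that] by simp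
  \<comment> \<open>On the way from \<open>x\<close> to the vertex \<open>X\<close>,
    \<open>f\<close> cannot vanish before the end: a zero puts \<open>l r\<close> into the section
    over the contraction, and for \<open>r < 1\<close> the cell of \<open>l r\<close> is that of
    \<open>x\<close>, so \<open>x\<close> would be in it too.\<close>
  have zero: "r = 1" if r: "0 \<le> r" "r \<le> 1" "f (l r) = 0" for r
  proof (rule ccontr)
    assume "r \<noteq> 1"
    have X1: "x $ i = 1 \<Longrightarrow> i \<in> X" "x $ i = 0 \<Longrightarrow> i \<notin> X" for i using X by (auto simp: cell_labels_def)
    have x01: "0 \<le> x $ i" "x $ i \<le> 1" for i using xF by (auto simp: subcube_def)
    have "carried_by (l r) x" using X1 by (auto simp: carried_by_def l_def)
    then have lQ: "l r \<in> ?Q'" using x lF[OF r(1,2)] by (rule carried_by_spanned_cells)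
    have hQ: "h (l r) \<in> ?Q''" using g(1)[OF lF[OF r(1,2)]] by (simp add: h_def)
    have "cube_proj V (l r) = cube_proj V (h (l r))" using fz[OF lF[OF r(1,2)]] r(3) by simp
    then have "l r = h (l r)" using Q'' hQ by (intro inj[OF lQ]) blast+
    with hQ have lQ'': "l r \<in> ?Q''" by simp
    have "carried_by x (l r)"
      unfolding carried_by_def
    proof (intro allI conjI impI)
      fix i
      assume "l r $ i = 0"
      then have "(1 - r) * x $ i + r * cube_vertex X $ i = 0" by (simp add: l_def del: cube_vertex_nth)
      moreover have "0 \<le> r * cube_vertex X $ i" "0 \<le> (1 - r) * x $ i" using r x01 by auto
      ultimately have "(1 - r) * x $ i = 0" by linarith
      then show "x $ i = 0" using \<open>r \<noteq> 1\<close> by simp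
    next
      fix i
      assume "l r $ i = 1"
      then have "(1 - r) * (1 - x $ i) + r * (1 - cube_vertex X $ i) = 0"
        by (simp add: l_def algebra_simps del: cube_vertex_nth)
      moreover have "0 \<le> r * (1 - cube_vertex X $ i)" "0 \<le> (1 - r) * (1 - x $ i)" using r x01 by auto
      ultimately have "(1 - r) * (1 - x $ i) = 0" by linarith
      then show "x $ i = 1" using \<open>r \<noteq> 1\<close> by simp
    qed
    then have "x \<in> ?Q''" using lQ'' xF by (rule carried_by_spanned_cells)
    then have "h x = x" using g(4) by (simp add: h_def)
    then have "f x = 0" by (simp add: f_def)
    with fx t show False by simp
  qed
  have cont_l: "continuous_on {0..1} (\<lambda>r. e * f (l r))"
  proof (intro continuous_on_mult continuous_on_const)
    have "continuous_on {0..1} l" unfolding l_def by (intro continuous_intros)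
    then show "continuous_on {0..1} (\<lambda>r. f (l r))"
      by (rule continuous_on_compose2 [OF cont]) (use lF in auto)
  qed
  have "e * f (cube_vertex X) \<ge> 0"
  proof (rule ccontr)
    assume "\<not> e * f (cube_vertex X) \<ge> 0"
    then obtain r where r: "0 \<le> r" "r \<le> 1" "e * f (l r) = 0"
      using IVT2'[of "\<lambda>r. e * f (l r)" 1 0 0] cont_l t fx by (auto simp: l_def)
    then have "r = 1" using zero e by auto
    with r(3) \<open>\<not> e * f (cube_vertex X) \<ge> 0\<close> show False by (auto simp: l_def)
  qed
  define y where "y = h (cube_vertex X)"
  have y: "y \<in> ?Q''" using g(1)[OF XF] by (simp add: y_def h_def)
  have py: "cube_proj V (cube_vertex X) = cube_proj V y + f (cube_vertex X) *\<^sub>R V n"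
    using fz[OF XF] by (simp add: y_def)
  show ?thesis
  proof (cases "f (cube_vertex X) = 0")
    case True
    have "cube_vertex X \<in> ?Q'" using X' XF by (simp add: spanned_cells_def)
    moreover have "cube_proj V (cube_vertex X) = cube_proj V y" using py True by simp
    ultimately have "cube_vertex X = y" using y Q'' by (intro inj) blast+
    then have "X \<in> link_sets n S" using y cell_labels_cube_vertex[of X] by (simp add: spanned_cells_def)
    then show ?thesis by (auto simp: link_sets_def)
  next
    case False
    define r where "r = f (cube_vertex X)"
    have er: "e * r > 0" using False e \<open>e * f (cube_vertex X) \<ge> 0\<close> by (auto simp: r_def)
    have yF: "y \<in> subcube ?F" using y by (simp add: spanned_cells_def)
    have y01: "0 \<le> y $ i" "y $ i \<le> 1" "y $ n = 0" for i using yF by (auto simp: subcube_def)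
    obtain Y where Y: "Y \<in> cell_labels y" "\<And>i. y $ i < cube_vertex X $ i \<Longrightarrow> i \<notin> Y \<or> y $ i = 1"
      "\<And>i. cube_vertex X $ i < y $ i \<Longrightarrow> i \<in> Y \<or> y $ i = 0"
      using cell_label_away_from[OF yF] by blast
    have "Y \<in> link_sets n S" using Y(1) y by (auto simp: spanned_cells_def)
    then have YS: "Y \<in> S" "insert n Y \<in> S" "n \<notin> Y" by (auto simp: link_sets_def)
    \<comment> \<open>A kernel vector witnessing that the wrong lift of \<open>X\<close> is not
      separated from \<open>Y\<close> or \<open>insert n Y\<close>. Its entry \<open>- r\<close> at
      \<open>n\<close> puts \<open>n\<close> on the side of \<open>Y\<close> for
      \<open>e = 1\<close> and on the side of \<open>X\<close> for \<open>e = -1\<close>.\<close>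
    define u where "u = set_coord n (- r) (cube_vertex X - y)"
    have pu: "cube_proj V u = 0" using py nX y01 by (simp add: u_def r_def cube_proj_set_coord)
    have u_pos: "i \<in> X - Y" if "u $ i > 0" "i \<noteq> n" for i
      using that Y(2)[of i] y01(1,2)[of i] by (auto simp: u_def split: if_splits)
    have u_neg: "i \<in> Y - X" if "u $ i < 0" "i \<noteq> n" for i
      using that Y(3)[of i] y01(1,2)[of i] by (auto simp: u_def split: if_splits)
    have un: "u $ n = - r" by (simp add: u_def)
    have "r \<noteq> 0" using er by auto
    then have "u \<noteq> 0" using un by auto
    from e show ?thesis
    proof
      assume e1: "e = 1"
      have "insert n X \<in> S"
      proof (rule ccontr)
        assume "insert n X \<notin> S"
        with X_or YS S(1) have "V_separated V X (insert n Y)" by (simp add: V_separated_collection_def)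
        then have "u = 0"
        proof (rule V_separatedD[OF _ pu])
          fix i
          show "i \<in> X - insert n Y" if "u $ i > 0"
            using u_pos[of i] that un er e1 by (cases "i = n") auto
          show "i \<in> insert n Y - X" if "u $ i < 0"
            using u_neg[of i] that nX by (cases "i = n") auto
        qed
        with \<open>u \<noteq> 0\<close> show False ..
      qed
      with e1 show ?thesis by simp
    next
      assume e1: "e = -1"
      have "X \<in> S"
      proof (rule ccontr)
        assume "X \<notin> S"
        with X_or YS S(1) have "V_separated V (insert n X) Y" by (simp add: V_separated_collection_def)
        then have "u = 0"
        proof (rule V_separatedD[OF _ pu])
          fix i
          show "i \<in> insert n X - Y" if "u $ i > 0"
            using u_pos[of i] that YS by (cases "i = n") auto
          show "i \<in> Y - insert n X" if "u $ i < 0"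
            using u_neg[of i] that un er e1 by (cases "i = n") auto
        qed
        with \<open>u \<noteq> 0\<close> show False ..
      qed
      with e1 show ?thesis by simp
    qed
  qed
qed

lemma cell_labels_set_coord:
  assumes "X \<in> cell_labels (set_coord n t x)" "x $ n = 0"
  shows "X - {n} \<in> cell_labels x" "t = 0 \<Longrightarrow> n \<notin> X" "t = 1 \<Longrightarrow> n \<in> X"
  using assms by (auto simp: cell_labels_def split: if_splits)

text \<open>Spanned cells are facial by construction and injective by separation, so only covering
  the zonotope is at stake. This is where the cardinality enters.\<close>

lemma spanned_cells_section:
  fixes V :: "'n::finite \<Rightarrow> 'a::euclidean_space"
  assumes "V_separated_collection V S" "S \<subseteq> Pow E" "card S = card (ind_sets E V)"
  shows "cubical_section E V (spanned_cells E S)"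
  using assms
proof (induction "card E" arbitrary: E V S)
  case 0
  then have E: "E = {}" by simp
  have "S = {{}}"
    using 0(3,4) by (auto simp: E ind_sets_empty card_1_singleton_iff)
  then have "spanned_cells E S = {0}"
    unfolding E by (auto simp: spanned_cells_def subcube_def cell_labels_def vec_eq_iff)
  moreover have "subcube E = {0 :: real^'n}" unfolding E by (auto simp: subcube_def vec_eq_iff)
  ultimately show ?case by (simp add: cubical_section_def facial_def)
next
  case (Suc k)
  then obtain n where n: "n \<in> E" by force
  with Suc have k: "k = card (E - {n})" by simp
  let ?F = "E - {n}" and ?S' = "(\<lambda>I. I - {n}) ` S"
  note S = Suc.prems(1,2)
  have S': "V_separated_collection V ?S'" "?S' \<subseteq> Pow ?F"
    using S V_separated_collection_deletion by auto
  have sub: "spanned_cells E S \<subseteq> subcube E" by (auto simp: spanned_cells_def)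
  have "cube_proj V ` subcube E \<subseteq> cube_proj V ` spanned_cells E S"
  proof (cases "V n = 0")
    case True
    have "link_sets n S = {}"
      using separated_agree_on_loop[OF S(1) True] by (auto simp: link_sets_def)
    then have "card ?S' = card (ind_sets ?F V)"
      using card_deletion_link[of S n] Suc.prems(3) ind_sets_loop[of n E V, OF n True] by simp
    then have sec: "cubical_section ?F V (spanned_cells ?F ?S')" by (rule Suc(1)[OF k S'])
    \<comment> \<open>For a zero vector, all members of \<open>S\<close> contain \<open>n\<close> or
      none does; \<open>t\<close> is the common coordinate.\<close>
    define t where "t = (if \<exists>I\<in>S. n \<in> I then 1 else 0 :: real)"
    show ?thesis
    proof clarify
      fix c assume "c \<in> subcube E"
      then have cF: "set_coord n 0 c \<in> subcube ?F" by (rule set_coord_0_in_subcube)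
      then obtain x where x: "x \<in> spanned_cells ?F ?S'" "cube_proj V x = cube_proj V (set_coord n 0 c)"
        by (rule cubical_section_cover [OF sec])
      have xF: "x \<in> subcube ?F" "x $ n = 0" using x by (auto simp: spanned_cells_def subcube_def)
      have "set_coord n t x \<in> spanned_cells E S"
        unfolding spanned_cells_def
      proof (intro CollectI conjI subsetI)
        show "set_coord n t x \<in> subcube E"
          using xF n by (intro set_coord_in_subcube_insert) (auto simp: t_def)
        fix X assume X: "X \<in> cell_labels (set_coord n t x)"
        then have "X - {n} \<in> ?S'"
          using cell_labels_set_coord(1)[OF X xF(2)] x by (auto simp: spanned_cells_def)
        then obtain I where I: "I \<in> S" "X - {n} = I - {n}" by blast
        have "n \<in> X \<longleftrightarrow> n \<in> I"
        proof (cases "\<exists>I\<in>S. n \<in> I")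
          case True
          then have "n \<in> I" using separated_agree_on_loop[OF S(1) \<open>V n = 0\<close>] I(1) by blast
          then show ?thesis using cell_labels_set_coord(3)[OF X xF(2)] True by (simp add: t_def)
        next
          case False
          then show ?thesis using cell_labels_set_coord(2)[OF X xF(2)] I(1) by (simp add: t_def)
        qed
        with I(2) have "X = I" by blast
        with I(1) show "X \<in> S" by simp
      qed
      moreover have "cube_proj V (set_coord n t x) = cube_proj V c"
        by (simp add: cube_proj_set_coord True x(2))
      ultimately show "cube_proj V c \<in> cube_proj V ` spanned_cells E S" by (metis imageI)
    qed
  next
    case False
    let ?W = "contraction V n" and ?S'' = "link_sets n S"
    have S'': "V_separated_collection ?W ?S''" "?S'' \<subseteq> Pow ?F"
      using V_separated_collection_contraction[OF S(1)] S(2) by (auto simp: link_sets_def)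
    \<comment> \<open>Two upper bounds whose sum is attained are both attained.\<close>
    have "card ?S' = card (ind_sets ?F V)" "card ?S'' = card (ind_sets ?F ?W)"
      using card_deletion_link[of S n] Suc.prems(3) card_ind_sets[of n E V, OF n False]
        card_V_separated_le[OF S'] card_V_separated_le[OF S''] by linarith+
    then have sec': "cubical_section ?F V (spanned_cells ?F ?S')"
      and sec'': "cubical_section ?F ?W (spanned_cells ?F ?S'')"
      using Suc(1)[OF k S'] Suc(1)[OF k S''] by auto
    have side: "set_coord n (if e = 1 then 1 else 0) x \<in> spanned_cells E S"
      if "x \<in> spanned_cells ?F ?S'" "x0 \<in> spanned_cells ?F ?S''"
        "cube_proj V x = cube_proj V x0 + t *\<^sub>R V n" "e * t > 0" "e = 1 \<or> e = (-1::real)" for x x0 t e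
      unfolding spanned_cells_def
    proof (intro CollectI conjI subsetI)
      have xF: "x \<in> subcube ?F" "x $ n = 0" using that(1) by (auto simp: spanned_cells_def subcube_def)
      show "set_coord n (if e = 1 then 1 else 0) x \<in> subcube E"
        using xF n by (intro set_coord_in_subcube_insert) auto
      fix X assume X: "X \<in> cell_labels (set_coord n (if e = 1 then 1 else 0) x)"
      note X' = cell_labels_set_coord[OF X xF(2)]
      have "(if e = 1 then insert n (X - {n}) else X - {n}) \<in> S"
        by (rule lifted_cell_labels[OF S n False sec'' that(1-4) X'(1) that(5)])
      moreover have "(if e = 1 then insert n (X - {n}) else X - {n}) = X"
        using X'(2,3) by (auto split: if_splits)
      ultimately show "X \<in> S" by simp
    qed
    show ?thesis
    proof clarify
      fix c assume c: "c \<in> subcube E"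
      let ?z = "set_coord n 0 c"
      have zF: "?z \<in> subcube ?F" using c by (rule set_coord_0_in_subcube)
      have c01: "0 \<le> c $ n" "c $ n \<le> 1" using c by (auto simp: subcube_def)
      obtain x0 where x0: "x0 \<in> spanned_cells ?F ?S''" "cube_proj ?W x0 = cube_proj ?W ?z"
        using cubical_section_cover[OF sec'' zF] by blast
      then obtain s where s: "cube_proj V ?z = cube_proj V x0 + s *\<^sub>R V n"
        using contraction_eq_iff[of V n ?z x0] by auto
      have x0F: "x0 \<in> subcube ?F" "x0 $ n = 0" using x0 by (auto simp: spanned_cells_def subcube_def)
      \<comment> \<open>Distance of \<open>c\<close> from the base \<open>x0\<close>, in units of
        \<open>V n\<close>. The prism layer covers 0 to 1; smaller values are below it and larger
        ones above.\<close>
      define r where "r = s + c $ n"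
      have pc: "cube_proj V c = cube_proj V x0 + r *\<^sub>R V n"
        using s by (simp add: cube_proj_set_coord r_def algebra_simps)
      have between: "\<exists>x\<in>spanned_cells ?F ?S'. cube_proj V x = cube_proj V x0 + (q * s) *\<^sub>R V n"
        if "0 \<le> q" "q \<le> 1" for q
      proof -
        have "(1 - q) *\<^sub>R x0 + q *\<^sub>R ?z \<in> subcube ?F"
          using convexD_alt[OF convex_subcube x0F(1) zF that] by simp
        from cubical_section_cover[OF sec' this]
        obtain x where "x \<in> spanned_cells ?F ?S'"
          "cube_proj V x = cube_proj V ((1 - q) *\<^sub>R x0 + q *\<^sub>R ?z)" by blast
        moreover have "cube_proj V ((1 - q) *\<^sub>R x0 + q *\<^sub>R ?z) = cube_proj V x0 + (q * s) *\<^sub>R V n"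
          by (simp add: s algebra_simps)
        ultimately show ?thesis by auto
      qed
      consider "0 \<le> r" "r \<le> 1" | "r < 0" | "r > 1" by linarith
      then show "cube_proj V c \<in> cube_proj V ` spanned_cells E S"
      proof cases
        case 1
        have "set_coord n r x0 \<in> spanned_cells E S"
          unfolding spanned_cells_def
        proof (intro CollectI conjI subsetI)
          show "set_coord n r x0 \<in> subcube E"
            using x0F n 1 by (intro set_coord_in_subcube_insert) auto
          fix X assume X: "X \<in> cell_labels (set_coord n r x0)"
          then have "X - {n} \<in> ?S''"
            using cell_labels_set_coord(1)[OF X x0F(2)] x0 by (auto simp: spanned_cells_def)
          then show "X \<in> S" by (cases "n \<in> X") (auto simp: link_sets_def insert_absorb)
        qed
        moreover have "cube_proj V (set_coord n r x0) = cube_proj V c"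
          by (simp add: cube_proj_set_coord x0F(2) pc)
        ultimately show ?thesis by (metis imageI)
      next
        case 2
        \<comment> \<open>Since \<open>c $ n \<ge> 0\<close>, here \<open>s \<le> r < 0\<close>: the
          target lies between \<open>x0\<close> and \<open>?z\<close>, hence in the zonotope of the
          deletion.\<close>
        then have "0 \<le> r / s" "r / s \<le> 1" "r / s * s = r" using c01 by (auto simp: r_def field_simps)
        then obtain x where x: "x \<in> spanned_cells ?F ?S'" "cube_proj V x = cube_proj V x0 + r *\<^sub>R V n"
          using between[of "r / s"] by auto
        have "set_coord n 0 x \<in> spanned_cells E S"
          using side[OF x(1) x0(1) x(2), of "-1"] 2 by simp
        moreover have "x $ n = 0" using x by (auto simp: spanned_cells_def subcube_def)
        then have "cube_proj V (set_coord n 0 x) = cube_proj V c" using x(2) pc by simp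
        ultimately show ?thesis by (metis imageI)
      next
        case 3
        \<comment> \<open>Undoing the shift by \<open>V n\<close> leaves distance
          \<open>r - 1\<close>, and \<open>c $ n \<le> 1\<close> gives
          \<open>0 < r - 1 \<le> s\<close>, again between \<open>x0\<close> and
          \<open>?z\<close>.\<close>
        then have "0 \<le> (r - 1) / s" "(r - 1) / s \<le> 1" "(r - 1) / s * s = r - 1"
          using c01 by (auto simp: r_def field_simps)
        then obtain x where x: "x \<in> spanned_cells ?F ?S'" "cube_proj V x = cube_proj V x0 + (r - 1) *\<^sub>R V n"
          using between[of "(r - 1) / s"] by auto
        have "set_coord n 1 x \<in> spanned_cells E S"
          using side[OF x(1) x0(1) x(2), of 1] 3 by simp
        moreover have "x $ n = 0" using x by (auto simp: spanned_cells_def subcube_def)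
        then have "cube_proj V (set_coord n 1 x) = cube_proj V c"
          using x(2) pc by (simp add: cube_proj_set_coord algebra_simps)
        ultimately show ?thesis by (metis imageI)
      qed
    qed
  qed
  moreover have "cube_proj V ` spanned_cells E S \<subseteq> cube_proj V ` subcube E"
    using sub by (rule image_mono)
  ultimately have "cube_proj V ` spanned_cells E S = cube_proj V ` subcube E" by (rule antisym[rotated])
  then show ?case
    using facial_spanned_cells inj_on_spanned_cells[OF S(1)] by (simp add: cubical_section_def)
qed

section \<open>Tilings\<close>

text \<open>No point can be added to \<open>Q\<close> among the spanned cells: its image is already
  covered by \<open>Q\<close>, and the projection is injective on them. This makes
  \<open>Vert\<close> injective.\<close>

lemma section_eq_spanned_cells:
  fixes V :: "'n::finite \<Rightarrow> 'a::euclidean_space"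
  assumes sec: "cubical_section E V Q"
  shows "Q = spanned_cells E (vertex_labels Q)"
proof
  note secD = cubical_sectionD[OF sec]
  let ?S = "spanned_cells E (vertex_labels Q)"
  show sub: "Q \<subseteq> ?S"
  proof
    fix x assume x: "x \<in> Q"
    then have xE: "x \<in> subcube E" using secD(4) by blast
    have "X \<in> vertex_labels Q" if X: "X \<in> cell_labels x" for X
    proof -
      have "X \<subseteq> E" using X xE by (auto simp: cell_labels_def subcube_def)
      moreover have "carried_by (cube_vertex X) x" using X by (auto simp: cell_labels_def carried_by_def)
      ultimately show ?thesis using secD(6)[OF x] by (simp add: vertex_labels_def)
    qed
    with xE show "x \<in> ?S" by (auto simp: spanned_cells_def)
  qed
  show "?S \<subseteq> Q"
  proof
    fix x assume x: "x \<in> ?S"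
    then have "x \<in> subcube E" by (simp add: spanned_cells_def)
    then obtain y where y: "y \<in> Q" "cube_proj V y = cube_proj V x"
      by (rule cubical_section_cover [OF sec])
    have "y = x"
      by (rule inj_onD [OF inj_on_spanned_cells [OF vertex_labels_separated [OF sec]] y(2)])
         (use x y sub in blast)+
    with y show "x \<in> Q" by simp
  qed
qed

lemma Ind_eq_ind_sets:
  fixes V :: "'n::finite \<Rightarrow> 'a::euclidean_space"
  shows "Ind V = ind_sets UNIV V"
proof -
  have "inj_on V I \<and> independent (V ` I) \<longleftrightarrow>
      (\<forall>x. (\<forall>i. i \<notin> I \<longrightarrow> x $ i = 0) \<longrightarrow> cube_proj V x = 0 \<longrightarrow> x = 0)" (is "?L \<longleftrightarrow> ?R") for I
  proof
    assume L: ?L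
    show ?R
    proof (intro allI impI)
      fix x :: "real^'n" assume x: "\<forall>i. i \<notin> I \<longrightarrow> x $ i = 0" "cube_proj V x = 0"
      define c where "c = (\<lambda>v. x $ inv_into I V v)"
      have c: "c (V i) = x $ i" if "i \<in> I" for i using L that by (simp add: c_def)
      have "(\<Sum>v\<in>V ` I. c v *\<^sub>R v) = (\<Sum>i\<in>I. x $ i *\<^sub>R V i)"
        using L c by (simp add: sum.reindex)
      also have "\<dots> = cube_proj V x"
        unfolding cube_proj_def by (rule sum.mono_neutral_left) (use x in auto)
      finally have "\<forall>v\<in>V ` I. c v = 0"
        using L x(2) independent_explicit[of "V ` I"] by auto
      then have "x $ i = 0" if "i \<in> I" for i using c[OF that] that by auto
      then show "x = 0" using x(1) by (metis vec_eq_iff zero_index)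
    qed
  next
    assume R: ?R
    have "inj_on V I"
    proof (rule inj_onI, rule ccontr)
      fix i j assume ij: "i \<in> I" "j \<in> I" "V i = V j" "i \<noteq> j"
      \<comment> \<open>Two equal vectors give a relation with coefficients 1 and -1.\<close>
      have "\<forall>k. k \<notin> I \<longrightarrow> (axis i 1 - axis j (1::real)) $ k = 0" using ij by (auto simp: axis_def)
      moreover have "cube_proj V (axis i 1 - axis j 1) = 0" using ij(3) by simp
      ultimately have "axis i 1 - axis j (1::real) = 0" using R by blast
      then have "(axis i 1 - axis j (1::real)) $ i = 0" by simp
      with ij(4) show False by (simp add: axis_def)
    qed
    moreover have "independent (V ` I)"
      unfolding independent_explicit
    proof (intro conjI allI impI ballI)
      fix c v assume c: "(\<Sum>v\<in>V ` I. c v *\<^sub>R v) = 0" and v: "v \<in> V ` I"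
      define x :: "real^'n" where "x = (\<chi> i. if i \<in> I then c (V i) else 0)"
      have "cube_proj V x = (\<Sum>i\<in>I. x $ i *\<^sub>R V i)"
        unfolding cube_proj_def by (rule sum.mono_neutral_right) (auto simp: x_def)
      also have "\<dots> = (\<Sum>v\<in>V ` I. c v *\<^sub>R v)"
        using \<open>inj_on V I\<close> by (simp add: sum.reindex x_def)
      finally have "x = 0" using R c by (auto simp: x_def)
      obtain i where "i \<in> I" "v = V i" using v by blast
      then have "c v = x $ i" by (simp add: x_def)
      with \<open>x = 0\<close> show "c v = 0" by simp
    qed simp
    ultimately show ?L by simp
  qed
  then show ?thesis by (auto simp: Ind_def ind_sets_def)
qed

section \<open>Faces of the cube\<close>

lemma cell_face_of_cube:
  fixes x :: "real^'n::finite"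
  shows "{y \<in> unit_cube. carried_by y x} face_of unit_cube"
  unfolding face_of_def
proof (intro conjI ballI impI)
  show "convex {y \<in> unit_cube. carried_by y x}"
  proof (rule convexI)
    fix a b :: "real^'n" and u v :: real
    assume *: "a \<in> {y \<in> unit_cube. carried_by y x}" "b \<in> {y \<in> unit_cube. carried_by y x}"
      "0 \<le> u" "0 \<le> v" "u + v = 1"
    then have "u *\<^sub>R a + v *\<^sub>R b \<in> unit_cube"
      unfolding unit_cube_eq by (intro convexD[OF convex_subcube]) auto
    moreover have "carried_by (u *\<^sub>R a + v *\<^sub>R b) x" using * by (simp add: carried_by_def)
    ultimately show "u *\<^sub>R a + v *\<^sub>R b \<in> {y \<in> unit_cube. carried_by y x}" by simp
  qed
  fix a b y :: "real^'n"
  assume *: "a \<in> unit_cube" "b \<in> unit_cube" "y \<in> {y \<in> unit_cube. carried_by y x}" "y \<in> open_segment a b"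
  then obtain t where t: "0 < t" "t < 1" "y = (1 - t) *\<^sub>R a + t *\<^sub>R b"
    by (auto simp: in_segment)
  have ab: "0 \<le> a $ i" "a $ i \<le> 1" "0 \<le> b $ i" "b $ i \<le> 1" for i using * by (auto simp: unit_cube_def)
  have "x $ i = 0 \<longrightarrow> a $ i = 0 \<and> b $ i = 0" for i
  proof
    assume "x $ i = 0"
    then have "(1 - t) * a $ i + t * b $ i = 0" using * t by (auto simp: carried_by_def)
    moreover have "0 \<le> (1 - t) * a $ i" "0 \<le> t * b $ i" using ab t by auto
    ultimately have "(1 - t) * a $ i = 0" "t * b $ i = 0" by linarith+
    with t show "a $ i = 0 \<and> b $ i = 0" by simp
  qed
  moreover have "x $ i = 1 \<longrightarrow> a $ i = 1 \<and> b $ i = 1" for i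
  proof
    assume "x $ i = 1"
    then have "(1 - t) * a $ i + t * b $ i = 1" using * t by (auto simp: carried_by_def)
    then have "(1 - t) * (1 - a $ i) + t * (1 - b $ i) = 0" by (simp add: algebra_simps)
    moreover have "0 \<le> (1 - t) * (1 - a $ i)" "0 \<le> t * (1 - b $ i)" using ab t by auto
    ultimately have "(1 - t) * (1 - a $ i) = 0" "t * (1 - b $ i) = 0" by linarith+
    with t show "a $ i = 1 \<and> b $ i = 1" by simp
  qed
  ultimately show "a \<in> {y \<in> unit_cube. carried_by y x}" "b \<in> {y \<in> unit_cube. carried_by y x}"
    using * by (auto simp: carried_by_def)
qed auto

text \<open>The segment from \<open>y\<close> to \<open>x\<close> can be prolonged a little beyond
  \<open>x\<close> inside the cube, so \<open>x\<close> is interior to a segment starting at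
  \<open>y\<close>, and the face must contain \<open>y\<close>.\<close>

lemma face_of_cube_carried_by:
  assumes F: "F face_of unit_cube" "x \<in> F" and y: "y \<in> unit_cube" "carried_by y x"
  shows "y \<in> F"
proof (cases "y = x")
  case False
  have x: "x \<in> unit_cube" using F by (auto simp: face_of_def)
  then obtain e where e: "e > 0" "x + e *\<^sub>R (x - y) \<in> unit_cube"
    using subcube_step[of x UNIV y x] y by (auto simp: unit_cube_eq)
  let ?z = "x + e *\<^sub>R (x - y)"
  have "?z - y = (1 + e) *\<^sub>R (x - y)" by (simp add: algebra_simps)
  with False e have "y \<noteq> ?z" by (metis eq_iff_diff_eq_0 scaleR_eq_0_iff add_pos_pos less_irrefl zero_less_one)
  moreover have "x = (1 - 1 / (1 + e)) *\<^sub>R y + (1 / (1 + e)) *\<^sub>R ?z"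
  proof -
    have "(1 - 1 / (1 + e)) *\<^sub>R y + (1 / (1 + e)) *\<^sub>R ?z = y + (1 / (1 + e)) *\<^sub>R (?z - y)"
      by (simp add: algebra_simps)
    also have "\<dots> = x" using e(1) by (simp add: \<open>?z - y = (1 + e) *\<^sub>R (x - y)\<close>)
    finally show ?thesis by simp
  qed
  ultimately have "x \<in> open_segment y ?z"
    using e(1) by (auto simp: in_segment intro!: exI[of _ "1 / (1 + e)"])
  then show ?thesis using F y(1) e(2) by (auto simp: face_of_def)
qed (use F in simp)

lemma singleton_vertex_face_of_cube: "{cube_vertex I} face_of unit_cube"
proof -
  have "{y \<in> unit_cube. carried_by y (cube_vertex I)} = {cube_vertex I}"
    by (auto simp: carried_by_def unit_cube_def vec_eq_iff split: if_splits)
  then show ?thesis using cell_face_of_cube[of "cube_vertex I"] by simp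
qed

lemma tiling_section:
  assumes T: "fine_zonotopal_tiling V T"
  shows "cubical_section UNIV V (\<Union>T)"
proof -
  have face: "F face_of unit_cube" if "F \<in> T" for F using T that by (simp add: fine_zonotopal_tiling_def)
  obtain g where g: "homeomorphism (\<Union>T) (zonotope V) (cube_proj V) g"
    using T by (auto simp: fine_zonotopal_tiling_def)
  have "facial UNIV (\<Union>T)"
    unfolding facial_def
  proof (intro conjI ballI impI)
    show "\<Union>T \<subseteq> subcube UNIV" using face face_of_imp_subset by (fastforce simp: unit_cube_eq)
    fix x y assume "x \<in> \<Union>T" "y \<in> subcube UNIV" "carried_by y x"
    then show "y \<in> \<Union>T" using face face_of_cube_carried_by by (metis UnionE UnionI unit_cube_eq)
  qed
  moreover have "inj_on (cube_proj V) (\<Union>T)"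
    using g by (metis homeomorphism_def inj_on_inverseI)
  moreover have "cube_proj V ` \<Union>T = cube_proj V ` subcube UNIV"
    using g unfolding homeomorphism_def zonotope_def unit_cube_eq by blast
  ultimately show ?thesis by (simp add: cubical_section_def)
qed

text \<open>A tiling is recovered from its union: a relative interior point of \<open>F\<close> lies
  in some member \<open>G\<close>, which forces \<open>F \<subseteq> G\<close>, and then
  \<open>F\<close> is a face of \<open>G\<close>.\<close>

lemma face_in_tiling_iff:
  assumes T: "fine_zonotopal_tiling V T"
  shows "F \<in> T \<longleftrightarrow> F face_of unit_cube \<and> F \<subseteq> \<Union>T"
proof
  assume F: "F face_of unit_cube \<and> F \<subseteq> \<Union>T"
  have face: "G face_of unit_cube" if "G \<in> T" for G using T that by (simp add: fine_zonotopal_tiling_def)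
  have sub: "H \<in> T" if "G \<in> T" "H face_of G" for G H using T that by (auto simp: fine_zonotopal_tiling_def)
  show "F \<in> T"
  proof (cases "F = {}")
    case True
    \<comment> \<open>The empty set counts as a face, so it belongs to \<open>T\<close> once
      \<open>T\<close> has any member; the zonotope is nonempty.\<close>
    have "cube_proj V 0 \<in> zonotope V"
      unfolding zonotope_def unit_cube_eq by (rule imageI [OF zero_in_subcube])
    then have "T \<noteq> {}" using T by (auto simp: fine_zonotopal_tiling_def homeomorphism_def)
    then show ?thesis using True sub empty_face_of by blast
  next
    case False
    have "convex F" using F face_of_imp_convex by blast
    then obtain x where x: "x \<in> rel_interior F" using False rel_interior_eq_empty by blast
    then obtain G where G: "G \<in> T" "x \<in> G" using F rel_interior_subset by blast
    have "F \<subseteq> G"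
      using subset_of_face_of[OF face[OF G(1)]] F x G(2) face_of_imp_subset by blast
    moreover have "G \<subseteq> unit_cube" using face[OF G(1)] by (rule face_of_imp_subset)
    ultimately have "F face_of G" using F face_of_subset by blast
    then show ?thesis using sub G by blast
  qed
qed (use assms in \<open>auto simp: fine_zonotopal_tiling_def\<close>)

lemma Vert_eq_vertex_labels:
  assumes "fine_zonotopal_tiling V T"
  shows "Vert T = vertex_labels (\<Union>T)"
  unfolding Vert_def vertex_labels_def face_in_tiling_iff[OF assms]
  by (simp add: singleton_vertex_face_of_cube)

text \<open>The smallest face around each point of \<open>Q\<close> lies in \<open>Q\<close>, so
  nothing is lost in the union; compactness of \<open>Q\<close> upgrades the bijection to a
  homeomorphism.\<close>

lemma section_tiling:
  fixes V :: "'n::finite \<Rightarrow> 'a::euclidean_space"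
  assumes sec: "cubical_section UNIV V Q"
  defines "T \<equiv> {F. F face_of unit_cube \<and> F \<subseteq> Q}"
  shows "fine_zonotopal_tiling V T" "\<Union>T = Q"
proof -
  note secD = cubical_sectionD[OF sec]
  show un: "\<Union>T = Q"
  proof
    show "Q \<subseteq> \<Union>T"
    proof
      fix x assume x: "x \<in> Q"
      let ?F = "{y \<in> unit_cube. carried_by y x}"
      have "?F \<subseteq> Q" using secD(6)[OF x] by (auto simp: unit_cube_eq)
      then have "?F \<in> T" using cell_face_of_cube by (simp add: T_def)
      moreover have "x \<in> ?F" using x secD(4) by (auto simp: unit_cube_eq)
      ultimately show "x \<in> \<Union>T" by blast
    qed
  qed (auto simp: T_def)
  have "\<exists>g. homeomorphism Q (zonotope V) (cube_proj V) g"
    using secD(2,3) unfolding zonotope_def unit_cube_eq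
    by (intro homeomorphism_compact compact_facial[OF secD(1)] continuous_on_cube_proj) auto
  moreover have "\<forall>F\<in>T. \<forall>G. G face_of F \<longrightarrow> G \<in> T"
  proof (intro ballI allI impI)
    fix F G assume "F \<in> T" "G face_of F"
    then show "G \<in> T" using face_of_trans face_of_imp_subset by (fastforce simp: T_def)
  qed
  moreover have "\<forall>F\<in>T. F face_of unit_cube" by (simp add: T_def)
  ultimately show "fine_zonotopal_tiling V T"
    unfolding fine_zonotopal_tiling_def un by (intro conjI)
qed

lemma max_by_size_separated_iff:
  fixes V :: "'n::finite \<Rightarrow> 'a::euclidean_space"
  shows "max_by_size_separated V S \<longleftrightarrow> V_separated_collection V S \<and> card S = card (ind_sets UNIV V)"
proof
  assume S: "max_by_size_separated V S"
  obtain Q where Q: "cubical_section UNIV V Q" using cubical_section_exists by blast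
  have "card (ind_sets UNIV V) \<le> card S"
    using S vertex_labels_separated[OF Q] card_vertex_labels[OF Q] unfolding max_by_size_separated_def by metis
  with S card_V_separated_le[of V S UNIV]
  show "V_separated_collection V S \<and> card S = card (ind_sets UNIV V)"
    by (simp add: max_by_size_separated_def)
next
  assume "V_separated_collection V S \<and> card S = card (ind_sets UNIV V)"
  then show "max_by_size_separated V S"
    using card_V_separated_le[of V _ UNIV] by (auto simp: max_by_size_separated_def)
qed

theorem theorem2p3:
  fixes V :: "'n::finite \<Rightarrow> 'a::euclidean_space"
  shows "bij_betw Vert {T. fine_zonotopal_tiling V T} {S. max_by_size_separated V S}
         \<and> (\<forall>S. max_by_size_separated V S \<longrightarrow> card S = card (Ind V))"
proof
  show "bij_betw Vert {T. fine_zonotopal_tiling V T} {S. max_by_size_separated V S}"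
  proof (rule bij_betwI')
    fix T T' assume TT': "T \<in> {T. fine_zonotopal_tiling V T}" "T' \<in> {T. fine_zonotopal_tiling V T}"
    show "Vert T = Vert T' \<longleftrightarrow> T = T'"
    proof
      assume "Vert T = Vert T'"
      then have "vertex_labels (\<Union>T) = vertex_labels (\<Union>T')"
        using TT' Vert_eq_vertex_labels[of V] by (metis mem_Collect_eq)
      then have "\<Union>T = \<Union>T'"
        using TT' section_eq_spanned_cells[OF tiling_section] by (metis mem_Collect_eq)
      then show "T = T'"
        using TT' face_in_tiling_iff[of V] by (metis mem_Collect_eq subsetI subset_antisym)
    qed simp
  next
    fix T assume "T \<in> {T. fine_zonotopal_tiling V T}"
    then have T: "fine_zonotopal_tiling V T" by simp
    then show "Vert T \<in> {S. max_by_size_separated V S}"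
      using vertex_labels_separated[OF tiling_section[OF T]] card_vertex_labels[OF tiling_section[OF T]]
      by (simp add: max_by_size_separated_iff Vert_eq_vertex_labels[OF T])
  next
    fix S assume "S \<in> {S. max_by_size_separated V S}"
    then have sec: "cubical_section UNIV V (spanned_cells UNIV S)"
      by (intro spanned_cells_section) (auto simp: max_by_size_separated_iff)
    have "S = Vert {F. F face_of unit_cube \<and> F \<subseteq> spanned_cells UNIV S}"
      by (simp add: Vert_eq_vertex_labels[OF section_tiling(1)[OF sec]] section_tiling(2)[OF sec]
          vertex_labels_spanned_cells)
    then show "\<exists>T\<in>{T. fine_zonotopal_tiling V T}. S = Vert T"
      using section_tiling(1)[OF sec] by blast
  qed
  show "\<forall>S. max_by_size_separated V S \<longrightarrow> card S = card (Ind V)"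
    by (simp add: max_by_size_separated_iff Ind_eq_ind_sets)
qed

end
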